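(* Let $G$ be a compact connected Lie group, $T$ a maximal torus of $G$ with Lie algebra $\mathfrak t$, and $\lambda\in\mathfrak t^*$. Then there exists a torus $T_1$ in $G$ such that $G_\lambda=C(T_1)$. If $\lambda$ is regular, then one can take $T_1=T$, and hence $G_\lambda=T$.
   Context: A torus is a compact connected abelian subgroup. $\mathfrak g$ is the Lie algebra of $G$; fix an $\mathrm{Ad}(G)$-invariant inner product on $\mathfrak g$ and regard $\mathfrak t^*\subset\mathfrak g^*$ by extending functionals by zero on $\mathfrak t^{\perp}$. $G_\lambda=\{g\in G:\mathrm{Ad}^*(g)\lambda=\lambda\}$ is the stabilizer for the coadjoint action $\langle\mathrm{Ad}^*(g)\lambda,X\rangle=\langle\lambda,\mathrm{Ad}(g^{-1})X\rangle$. $C(S)$ denotes the centralizer of $S$ in $G$. A functional $\lambda\in\mathfrak t^*$ is called regular if $G_\lambda=T$. *)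

theory Defs
  imports "HOL-Analysis.Analysis" "HOL-Algebra.Group_Action"
begin

(* C^k for functions on an open set of a finite-dimensional space.  There, continuity of all
   iterated directional derivatives up to order k amounts to continuity of the k-th Frechet
   derivative. *)
fun Ck_on :: "nat \<Rightarrow> 'v::real_normed_vector set \<Rightarrow> ('v \<Rightarrow> 'w::real_normed_vector) \<Rightarrow> bool" where
  "Ck_on 0 S f \<longleftrightarrow> continuous_on S f"
| "Ck_on (Suc k) S f \<longleftrightarrow>
     (\<exists>f'. (\<forall>x\<in>S. (f has_derivative f' x) (at x)) \<and> (\<forall>v. Ck_on k S (\<lambda>x. f' x v)))"

definition smooth_on :: "'v::real_normed_vector set \<Rightarrow> ('v \<Rightarrow> 'w::real_normed_vector) \<Rightarrow> bool" where
  "smooth_on S f \<longleftrightarrow> open S \<and> (\<forall>k. Ck_on k S f)"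

type_synonym ('a, 'v) chart = "'a set \<times> ('a \<Rightarrow> 'v)"

(* The model space R^n is a finite-dimensional real inner product space.  The class
   euclidean_space is not used because it forces n > 0.  An atlas need not be maximal. *)
definition smooth_manifold :: "'a topology \<Rightarrow> ('a, 'v::real_inner) chart set \<Rightarrow> bool" where
  "smooth_manifold X A \<longleftrightarrow>
     (\<exists>B::'v set. finite B \<and> span B = UNIV) \<and>
     Hausdorff_space X \<and> second_countable X \<and>
     (\<Union>(U, \<phi>)\<in>A. U) = topspace X \<and>
     (\<forall>(U, \<phi>)\<in>A. openin X U \<and> open (\<phi> ` U) \<and>
        homeomorphic_map (subtopology X U) (top_of_set (\<phi> ` U)) \<phi>) \<and>
     (\<forall>(U, \<phi>)\<in>A. \<forall>(V, \<psi>)\<in>A. smooth_on (\<phi> ` (U \<inter> V)) (\<psi> \<circ> inv_into U \<phi>))"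

definition smooth_map_on ::
    "'a topology \<Rightarrow> ('a, 'v::real_normed_vector) chart set \<Rightarrow>
     'b topology \<Rightarrow> ('b, 'w::real_normed_vector) chart set \<Rightarrow> 'a set \<Rightarrow> ('a \<Rightarrow> 'b) \<Rightarrow> bool" where
  "smooth_map_on X A Y B W f \<longleftrightarrow>
     openin X W \<and> continuous_map (subtopology X W) Y f \<and>
     (\<forall>(U, \<phi>)\<in>A. \<forall>(V, \<psi>)\<in>B.
        smooth_on (\<phi> ` {x \<in> U \<inter> W. f x \<in> V}) (\<psi> \<circ> f \<circ> inv_into U \<phi>))"

definition prod_atlas ::
    "('a, 'v) chart set \<Rightarrow> ('b, 'w) chart set \<Rightarrow> ('a \<times> 'b, 'v \<times> 'w) chart set" where
  "prod_atlas A B = {(U \<times> V, map_prod \<phi> \<psi>) | U \<phi> V \<psi>. (U, \<phi>) \<in> A \<and> (V, \<psi>) \<in> B}"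

definition real_atlas :: "(real, real) chart set" where
  "real_atlas = {(UNIV, id)}"

record ('a, 'v) smooth_group = "'a monoid" +
  topol :: "'a topology"
  atlas :: "('a, 'v) chart set"

locale lie_group = group G for G :: "('a, 'v::real_inner) smooth_group" (structure) +
  assumes topspace_eq: "topspace (topol G) = carrier G"
    and manifold: "smooth_manifold (topol G) (atlas G)"
    and smooth_mult:
      "smooth_map_on (prod_topology (topol G) (topol G)) (prod_atlas (atlas G) (atlas G))
         (topol G) (atlas G) (carrier G \<times> carrier G) (\<lambda>(x, y). x \<otimes> y)"
    and smooth_inv:
      "smooth_map_on (topol G) (atlas G) (topol G) (atlas G) (carrier G) (\<lambda>x. inv x)"

definition smooth_germ :: "('a, 'v::real_inner) smooth_group \<Rightarrow> 'a \<Rightarrow> ('a \<Rightarrow> real) \<Rightarrow> bool" where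
  "smooth_germ G p f \<longleftrightarrow>
     (\<exists>W. p \<in> W \<and> smooth_map_on (topol G) (atlas G) euclidean real_atlas W f)"

(* A tangent vector is the directional derivative operator f \<mapsto> (f \<circ> c)'(0) of a smooth curve c,
   acting on the functions that are smooth near c 0; the value 0 on all other functions is a
   convention that makes such operators equal as soon as they agree on smooth functions.
   The vector space operations on tangent vectors are the pointwise ones. *)
type_synonym 'a tangent = "('a \<Rightarrow> real) \<Rightarrow> real"

definition velocity :: "('a, 'v::real_inner) smooth_group \<Rightarrow> (real \<Rightarrow> 'a) \<Rightarrow> 'a tangent" where
  "velocity G c = (\<lambda>f. if smooth_germ G (c 0) f then deriv (f \<circ> c) 0 else 0)"

(* The Lie algebra (as a vector space; the bracket is not needed) of a closed subgroup H of G: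
   its tangent space at the identity, realised inside that of G.  Closed subgroups are embedded
   submanifolds, so the smooth curves in H are the smooth curves of G with values in H.
   The Lie algebra of G itself is the case H = carrier G. *)
definition lie_algebra :: "('a, 'v::real_inner) smooth_group \<Rightarrow> 'a set \<Rightarrow> 'a tangent set" where
  "lie_algebra G H = {velocity G c | c. c 0 = \<one>\<^bsub>G\<^esub> \<and>
     (\<exists>W. 0 \<in> W \<and> c ` W \<subseteq> H \<and>
        smooth_map_on euclidean real_atlas (topol G) (atlas G) W c)}"

(* The differential at the identity of conjugation by g. *)
definition Ad :: "('a, 'v) smooth_group \<Rightarrow> 'a \<Rightarrow> 'a tangent \<Rightarrow> 'a tangent" where
  "Ad G g X = (\<lambda>f. X (\<lambda>x. f (g \<otimes>\<^bsub>G\<^esub> x \<otimes>\<^bsub>G\<^esub> inv\<^bsub>G\<^esub> g)))"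

(* Functionals on V are extensional, so that equality of functions is equality on V. *)
definition dual :: "'a tangent set \<Rightarrow> ('a tangent \<Rightarrow> real) set" where
  "dual V = {\<xi> \<in> extensional V.
     (\<forall>X\<in>V. \<forall>Y\<in>V. \<xi> (\<lambda>f. X f + Y f) = \<xi> X + \<xi> Y) \<and>
     (\<forall>a. \<forall>X\<in>V. \<xi> (\<lambda>f. a * X f) = a * \<xi> X)}"

definition inner_product_on :: "'a tangent set \<Rightarrow> ('a tangent \<Rightarrow> 'a tangent \<Rightarrow> real) \<Rightarrow> bool" where
  "inner_product_on V B \<longleftrightarrow>
     (\<forall>X\<in>V. \<forall>Y\<in>V. B X Y = B Y X) \<and>
     (\<forall>X\<in>V. \<forall>Y\<in>V. \<forall>Z\<in>V. B (\<lambda>f. X f + Y f) Z = B X Z + B Y Z) \<and>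
     (\<forall>a. \<forall>X\<in>V. \<forall>Y\<in>V. B (\<lambda>f. a * X f) Y = a * B X Y) \<and>
     (\<forall>X\<in>V. X \<noteq> (\<lambda>f. 0) \<longrightarrow> B X X > 0)"

definition Ad_invariant ::
    "('a, 'v::real_inner) smooth_group \<Rightarrow> ('a tangent \<Rightarrow> 'a tangent \<Rightarrow> real) \<Rightarrow> bool" where
  "Ad_invariant G B \<longleftrightarrow>
     (\<forall>g\<in>carrier G. \<forall>X\<in>lie_algebra G (carrier G). \<forall>Y\<in>lie_algebra G (carrier G).
        B (Ad G g X) (Ad G g Y) = B X Y)"

(* The copy of the dual of W in the dual of V: extensions by zero on the B-orthogonal
   complement of W. *)
definition embedded_dual ::
    "'a tangent set \<Rightarrow> ('a tangent \<Rightarrow> 'a tangent \<Rightarrow> real) \<Rightarrow> 'a tangent set \<Rightarrow>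
     ('a tangent \<Rightarrow> real) set" where
  "embedded_dual V B W = {\<xi> \<in> dual V.
     (\<exists>\<mu>\<in>dual W. \<forall>X\<in>W. \<xi> X = \<mu> X) \<and>
     (\<forall>X\<in>V. (\<forall>Y\<in>W. B X Y = 0) \<longrightarrow> \<xi> X = 0)}"

definition coAd ::
    "('a, 'v::real_inner) smooth_group \<Rightarrow> 'a \<Rightarrow> ('a tangent \<Rightarrow> real) \<Rightarrow> 'a tangent \<Rightarrow> real" where
  "coAd G g \<xi> = (\<lambda>X\<in>lie_algebra G (carrier G). \<xi> (Ad G (inv\<^bsub>G\<^esub> g) X))"

definition torus_in :: "('a, 'v) smooth_group \<Rightarrow> 'a set \<Rightarrow> bool" where
  "torus_in G S \<longleftrightarrow> subgroup S G \<and> comm_group (G\<lparr>carrier := S\<rparr>) \<and>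
     compactin (topol G) S \<and> connectedin (topol G) S"

definition maximal_torus_in :: "('a, 'v) smooth_group \<Rightarrow> 'a set \<Rightarrow> bool" where
  "maximal_torus_in G T \<longleftrightarrow> torus_in G T \<and> (\<forall>S. torus_in G S \<and> T \<subseteq> S \<longrightarrow> S = T)"

definition centralizer :: "('a, 'v) smooth_group \<Rightarrow> 'a set \<Rightarrow> 'a set" where
  "centralizer G S = {g \<in> carrier G. \<forall>s\<in>S. g \<otimes>\<^bsub>G\<^esub> s = s \<otimes>\<^bsub>G\<^esub> g}"

definition regular_functional ::
    "('a, 'v::real_inner) smooth_group \<Rightarrow> 'a set \<Rightarrow> ('a tangent \<Rightarrow> real) \<Rightarrow> bool" where
  "regular_functional G T \<xi> \<longleftrightarrow> stabilizer G (coAd G) \<xi> = T"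

end

theory Submission
  imports Defs "HOL-Algebra.Generated_Groups"
begin

text \<open>
The invariant inner product turns \<open>\<xi>\<close> into a vector \<open>h\<close> of the Lie algebra, and invariance turns the
stabilizer of \<open>\<xi>\<close> into the stabilizer of \<open>h\<close> under the adjoint action (\<open>functional_representative\<close>,
\<open>stabilizer_eq\<close>).  Let \<open>c\<close> be the one-parameter subgroup with velocity \<open>h\<close>.  An element \<open>g\<close> fixes \<open>h\<close>
if and only if conjugation by \<open>g\<close> fixes \<open>c\<close>, because \<open>g c g\<inverse>\<close> is the one-parameter subgroup with
velocity \<open>Ad g h\<close> (\<open>Ad_fixed_eq_centralizer\<close>).  Hence the stabilizer is the centralizer of the image
of \<open>c\<close>, and so it is the centralizer of the closure \<open>T\<^sub>1\<close> of the group generated by that image.  This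
closure is abelian and connected because the image of \<open>c\<close> is, and it is compact because \<open>G\<close> is
(\<open>torus_generated_by_commuting_set\<close>).

If the stabilizer is \<open>T\<close> itself, then \<open>T\<^sub>1 \<subseteq> C(T\<^sub>1) = T\<close>, hence \<open>C(T) \<subseteq> C(T\<^sub>1) = T\<close>, while
\<open>T \<subseteq> C(T)\<close> since \<open>T\<close> is abelian.

Only a short piece of \<open>c\<close> around the identity is constructed, as it generates the same group.
It exists by Picard iteration for the left-invariant vector field in a chart at the identity
(\<open>integral_curve_exists\<close>).  Its uniqueness (\<open>body_velocity_unique_curve\<close>) rests on the fact that the
quotient of two solutions has zero derivative; commutativity of the image of \<open>c\<close> and its behaviour
under conjugation both follow from it.  The remaining work is calculus: smooth maps between
manifolds compose, so that all words in the group operations are smooth, and a chart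
identifies the Lie algebra with the model space (\<open>lie_algebra_eq\<close>).
\<close>

section \<open>Coordinates in a finite-dimensional inner product space\<close>

text \<open>The model space is an inner product space spanned by a finite set, and it may have dimension
zero, so it is not an instance of the class of Euclidean spaces.  The expansion identity below is
what remains of an orthonormal basis in this setting.\<close>

definition coordinate_frame :: "'v::real_inner set \<Rightarrow> bool" where
  "coordinate_frame E \<longleftrightarrow> finite E \<and> (\<forall>x. x = (\<Sum>b\<in>E. (x \<bullet> b) *\<^sub>R b))"

lemma coordinate_frame_finite: "coordinate_frame E \<Longrightarrow> finite E"
  by (simp add: coordinate_frame_def)

lemma coordinate_frame_expansion: "coordinate_frame E \<Longrightarrow> (\<Sum>b\<in>E. (x \<bullet> b) *\<^sub>R b) = x"
  by (metis coordinate_frame_def)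

text \<open>Gram--Schmidt: normalise an orthogonal spanning set; the defect of the expansion is then
orthogonal to everything, itself included.\<close>

lemma coordinate_frame_exists:
  fixes D :: "'v::real_inner set"
  assumes "finite D" "span D = UNIV"
  shows "\<exists>E::'v set. coordinate_frame E"
proof -
  obtain C :: "'v set" where C: "finite C" "span C = UNIV" "pairwise orthogonal C"
    using basis_orthogonal[OF assms(1)] assms(2) by auto
  define E where "E = (\<lambda>b. b /\<^sub>R norm b) ` (C - {0})"
  have fin: "finite E" using C by (simp add: E_def)
  have unit: "b \<bullet> b = 1" if "b \<in> E" for b
  proof -
    obtain c where "c \<noteq> 0" "b = c /\<^sub>R norm c" using \<open>b \<in> E\<close> by (auto simp: E_def)
    then have "norm b = 1" by simp
    then show ?thesis by (simp add: dot_square_norm)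
  qed
  have orth: "b \<bullet> c = 0" if "b \<in> E" "c \<in> E" "b \<noteq> c" for b c
    using that C(3) by (fastforce simp: E_def pairwise_def orthogonal_def)
  have "C - {0} \<subseteq> span E"
  proof
    fix b assume b: "b \<in> C - {0}"
    then have "b = norm b *\<^sub>R (b /\<^sub>R norm b)" by simp
    moreover have "b /\<^sub>R norm b \<in> span E" using b by (auto simp: E_def intro: span_base)
    ultimately show "b \<in> span E" by (metis span_scale)
  qed
  then have "span C \<subseteq> span E"
    by (metis insert_Diff_single span_insert_0 span_minimal subspace_span span_mono span_span)
  then have span: "span E = UNIV" using C by auto
  have "x = (\<Sum>b\<in>E. (x \<bullet> b) *\<^sub>R b)" for x
  proof -
    let ?d = "x - (\<Sum>b\<in>E. (x \<bullet> b) *\<^sub>R b)"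
    have "orthogonal ?d c" if "c \<in> E" for c
    proof -
      have "(\<Sum>b\<in>E. (x \<bullet> b) * (b \<bullet> c)) = (\<Sum>b\<in>E. if b = c then x \<bullet> c else 0)"
        by (rule sum.cong) (auto simp: unit orth that)
      then show ?thesis
        using that fin by (simp add: orthogonal_def inner_diff_left inner_sum_left)
    qed
    then have "orthogonal ?d ?d" using orthogonal_to_span[of ?d E ?d] span by auto
    then show ?thesis by (simp add: orthogonal_def)
  qed
  with fin show ?thesis unfolding coordinate_frame_def by blast
qed

lemma coordinate_frame_prod:
  fixes E :: "'v::real_inner set" and F :: "'w::real_inner set"
  assumes "coordinate_frame E" "coordinate_frame F"
  shows "\<exists>P :: ('v \<times> 'w) set. coordinate_frame P"
proof -
  let ?E = "(\<lambda>b. (b, 0::'w)) ` E" and ?F = "(\<lambda>b. (0::'v, b)) ` F"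
  have sp: "span (?E \<union> ?F) = UNIV"
  proof -
    have "(x, y) \<in> span (?E \<union> ?F)" for x y
    proof -
      have "(x, 0) = (\<Sum>b\<in>E. (x \<bullet> b) *\<^sub>R (b, 0::'w))"
        using coordinate_frame_expansion[OF assms(1), of x] by (simp add: prod_eq_iff fst_sum snd_sum)
      moreover have "(0, y) = (\<Sum>b\<in>F. (y \<bullet> b) *\<^sub>R (0::'v, b))"
        using coordinate_frame_expansion[OF assms(2), of y] by (simp add: prod_eq_iff fst_sum snd_sum)
      moreover have "(\<Sum>b\<in>E. (x \<bullet> b) *\<^sub>R (b, 0::'w)) \<in> span (?E \<union> ?F)"
        by (intro span_sum span_scale span_base) auto
      moreover have "(\<Sum>b\<in>F. (y \<bullet> b) *\<^sub>R (0::'v, b)) \<in> span (?E \<union> ?F)"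
        by (intro span_sum span_scale span_base) auto
      ultimately have "(x, 0) + (0, y) \<in> span (?E \<union> ?F)"
        by (metis span_add)
      then show ?thesis by simp
    qed
    then show ?thesis by auto
  qed
  have "finite (?E \<union> ?F)" using assms by (simp add: coordinate_frame_def)
  then show ?thesis using coordinate_frame_exists[OF _ sp] by blast
qed

lemma linear_frame_expansion:
  assumes "coordinate_frame E" "linear l"
  shows "l x = (\<Sum>b\<in>E. (x \<bullet> b) *\<^sub>R l b)"
proof -
  have "l x = l (\<Sum>b\<in>E. (x \<bullet> b) *\<^sub>R b)" using coordinate_frame_expansion[OF assms(1)] by simp
  also have "\<dots> = (\<Sum>b\<in>E. (x \<bullet> b) *\<^sub>R l b)"
    using assms(2) by (simp add: linear_sum linear_scale)
  finally show ?thesis .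
qed

text \<open>The Riesz representation theorem for an arbitrary positive definite form.  The form is
\<open>\<Psi> u \<bullet> w\<close> for an operator \<open>\<Psi>\<close> that positivity makes injective, hence surjective by finite
dimension, so the Euclidean representative of the functional has a preimage under \<open>\<Psi>\<close>.\<close>

lemma form_represents_functional:
  fixes b :: "'v::real_inner \<Rightarrow> 'v \<Rightarrow> real"
  assumes E: "coordinate_frame (E :: 'v set)"
    and left: "\<And>w. linear (\<lambda>u. b u w)" and right: "\<And>u. linear (b u)"
    and pos: "\<And>u. u \<noteq> 0 \<Longrightarrow> b u u > 0" and l: "linear l"
  shows "\<exists>h. \<forall>w. b h w = l w"
proof -
  obtain D :: "'v set" where D: "D \<subseteq> E" "independent D" "E \<subseteq> span D"
    using maximal_independent_subset by blast
  have "x \<in> span E" for x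
  proof -
    have "(\<Sum>b\<in>E. (x \<bullet> b) *\<^sub>R b) \<in> span E" by (intro span_sum span_scale span_base)
    then show ?thesis using coordinate_frame_expansion[OF E] by simp
  qed
  then have "span D = UNIV"
    using D(3) span_minimal[OF D(3) subspace_span] by auto
  moreover have "finite D" using D(1) E by (meson coordinate_frame_finite finite_subset)
  ultimately interpret finite_dimensional_vector_space scaleR D
    using D(2) by unfold_locales (auto simp: algebra_simps span_raw_def dependent_raw_def)
  define \<Psi> where "\<Psi> u = (\<Sum>c\<in>E. b u c *\<^sub>R c)" for u
  have lin: "linear \<Psi>"
    unfolding \<Psi>_def
    by (rule linearI)
      (simp_all add: linear_add[OF left] linear_scale[OF left] scaleR_add_left sum.distrib scaleR_sum_right)
  have exp: "b u w = \<Psi> u \<bullet> w" for u w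
    using linear_frame_expansion[OF E right, of u w]
    by (simp add: \<Psi>_def inner_sum_left inner_commute[of w] mult.commute)
  have "inj \<Psi>"
    unfolding linear_injective_0[OF lin]
  proof (intro allI impI)
    fix u assume "\<Psi> u = 0"
    then have "b u u = 0" by (simp add: exp)
    then show "u = 0" using pos[of u] by force
  qed
  then have "surj \<Psi>"
    using linear_inj_imp_surj[of \<Psi>] lin by (simp add: linear_def)
  then obtain h where h: "\<Psi> h = (\<Sum>c\<in>E. l c *\<^sub>R c)" by (metis surjD)
  have "b h w = l w" for w
    using linear_frame_expansion[OF E l, of w]
    by (simp add: exp h inner_sum_left inner_commute[of w] mult.commute)
  then show ?thesis by blast
qed

section \<open>Calculus of functions with continuous iterated derivatives\<close>

lemma Ck_on_cong:
  assumes "open S" "\<And>x. x \<in> S \<Longrightarrow> f x = g x" "Ck_on k S f"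
  shows "Ck_on k S g"
proof (cases k)
  case 0
  with assms show ?thesis by (simp cong: continuous_on_cong)
next
  case (Suc j)
  with assms obtain f' where f': "\<forall>x\<in>S. (f has_derivative f' x) (at x)" "\<forall>v. Ck_on j S (\<lambda>x. f' x v)"
    by auto
  have "(g has_derivative f' x) (at x)" if "x \<in> S" for x
    using f'(1) that assms(1,2) by (meson has_derivative_transform_within_open)
  with f'(2) Suc show ?thesis by auto
qed

lemma Ck_on_subset: "Ck_on k S f \<Longrightarrow> T \<subseteq> S \<Longrightarrow> Ck_on k T f"
proof (induction k arbitrary: f)
  case 0 then show ?case by (auto intro: continuous_on_subset)
next
  case (Suc k) then show ?case by (auto 4 4)
qed

lemma Ck_on_Suc_imp: "Ck_on (Suc k) S f \<Longrightarrow> Ck_on k S f"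
proof (induction k arbitrary: f)
  case 0
  then show ?case
    by (auto intro!: continuous_at_imp_continuous_on intro: has_derivative_continuous)
next
  case (Suc k)
  then show ?case by (metis Ck_on.simps(2))
qed

text \<open>On an open set the derivative in the recursive clause is unique.  Naming it canonically is what
allows local statements to be glued.\<close>

lemma Ck_on_iff_frechet:
  "Ck_on (Suc k) S f \<longleftrightarrow>
     (\<forall>x\<in>S. f differentiable at x) \<and> (\<forall>v. Ck_on k S (\<lambda>x. frechet_derivative f (at x) v))"
  if "open S"
proof (intro iffI conjI ballI allI)
  assume "Ck_on (Suc k) S f"
  then obtain f' where f': "\<forall>x\<in>S. (f has_derivative f' x) (at x)" "\<forall>v. Ck_on k S (\<lambda>x. f' x v)"
    by auto
  show "f differentiable at x" if "x \<in> S" for x using f' that unfolding differentiable_def by blast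
  show "Ck_on k S (\<lambda>x. frechet_derivative f (at x) v)" for v
    using f' by (intro Ck_on_cong[OF that _ f'(2)[rule_format, of v]]) (metis frechet_derivative_at)
next
  assume *: "(\<forall>x\<in>S. f differentiable at x) \<and> (\<forall>v. Ck_on k S (\<lambda>x. frechet_derivative f (at x) v))"
  then have "\<forall>x\<in>S. (f has_derivative frechet_derivative f (at x)) (at x)"
    by (simp add: frechet_derivative_works)
  then show "Ck_on (Suc k) S f"
    unfolding Ck_on.simps using conjunct2[OF *] by (intro exI[of _ "\<lambda>x. frechet_derivative f (at x)"] conjI)
qed

lemma Ck_on_local:
  assumes "open S" "\<And>x. x \<in> S \<Longrightarrow> \<exists>N. open N \<and> x \<in> N \<and> N \<subseteq> S \<and> Ck_on k N f"
  shows "Ck_on k S f"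
  using assms(2)
proof (induction k arbitrary: f)
  case 0
  show ?case
    unfolding Ck_on.simps
  proof (rule continuous_at_imp_continuous_on, rule ballI)
    fix x assume "x \<in> S"
    then obtain N where "open N" "x \<in> N" "continuous_on N f"
      using 0[of x] unfolding Ck_on.simps by blast
    then show "isCont f x" by (simp add: continuous_on_eq_continuous_at)
  qed
next
  case (Suc k)
  have *: "\<exists>N. open N \<and> x \<in> N \<and> N \<subseteq> S \<and> (\<forall>x\<in>N. f differentiable at x) \<and>
      (\<forall>v. Ck_on k N (\<lambda>x. frechet_derivative f (at x) v))" if "x \<in> S" for x
    using Suc.prems[OF that] by (auto simp: Ck_on_iff_frechet simp del: Ck_on.simps)
  show ?case
    unfolding Ck_on_iff_frechet[OF assms(1)]
  proof (intro conjI ballI allI)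
    fix x assume "x \<in> S"
    from *[OF this] show "f differentiable at x" by auto
  next
    fix v show "Ck_on k S (\<lambda>x. frechet_derivative f (at x) v)"
    proof (rule Suc.IH)
      fix x assume "x \<in> S"
      from *[OF this] show "\<exists>N. open N \<and> x \<in> N \<and> N \<subseteq> S \<and>
          Ck_on k N (\<lambda>x. frechet_derivative f (at x) v)" by auto
    qed
  qed
qed

lemma Ck_on_const: "Ck_on k S (\<lambda>x. c)"
proof (induction k arbitrary: c)
  case (Suc k)
  show ?case unfolding Ck_on.simps by (rule exI[of _ "\<lambda>x v. 0"]) (use Suc in auto)
qed simp

lemma Ck_on_bounded_linear: "bounded_linear h \<Longrightarrow> Ck_on k S h"
proof (cases k)
  case (Suc j)
  assume h: "bounded_linear h"
  show ?thesis
    unfolding Suc Ck_on.simps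
    by (rule exI[of _ "\<lambda>x. h"]) (use h in \<open>auto intro: bounded_linear_imp_has_derivative Ck_on_const\<close>)
qed (simp add: linear_continuous_on)

lemma Ck_on_bounded_linear_comp:
  assumes "bounded_linear h"
  shows "Ck_on k S f \<Longrightarrow> Ck_on k S (\<lambda>x. h (f x))"
proof (induction k arbitrary: f)
  case 0
  then show ?case using assms
    by (auto intro!: continuous_on_compose2[OF linear_continuous_on[OF assms, of UNIV]])
next
  case (Suc k)
  then obtain f' where f': "\<forall>x\<in>S. (f has_derivative f' x) (at x)" "\<forall>v. Ck_on k S (\<lambda>x. f' x v)"
    by auto
  show ?case
    unfolding Ck_on.simps
    by (rule exI[of _ "\<lambda>x v. h (f' x v)"])
      (use f' Suc.IH in \<open>auto intro!: bounded_linear.has_derivative[OF assms]\<close>)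
qed

lemma Ck_on_add: "Ck_on k S f \<Longrightarrow> Ck_on k S g \<Longrightarrow> Ck_on k S (\<lambda>x. f x + g x)"
proof (induction k arbitrary: f g)
  case 0 then show ?case by (auto intro: continuous_intros)
next
  case (Suc k)
  then obtain f' g' where f': "\<forall>x\<in>S. (f has_derivative f' x) (at x)" "\<forall>v. Ck_on k S (\<lambda>x. f' x v)"
    and g': "\<forall>x\<in>S. (g has_derivative g' x) (at x)" "\<forall>v. Ck_on k S (\<lambda>x. g' x v)"
    by auto
  show ?case
    unfolding Ck_on.simps
    by (rule exI[of _ "\<lambda>x v. f' x v + g' x v"])
      (use f' g' Suc.IH in \<open>auto intro!: derivative_intros\<close>)
qed

lemma Ck_on_sum:
  assumes "\<And>i. i \<in> I \<Longrightarrow> Ck_on k S (f i)"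
  shows "Ck_on k S (\<lambda>x. \<Sum>i\<in>I. f i x)"
  using assms by (induction I rule: infinite_finite_induct) (auto intro: Ck_on_const Ck_on_add)

lemma Ck_on_Pair:
  assumes "Ck_on k S f" "Ck_on k S g"
  shows "Ck_on k S (\<lambda>x. (f x, g x))"
proof -
  have l: "bounded_linear (\<lambda>x. (x, 0))" and r: "bounded_linear (\<lambda>x. (0, x))"
    by (auto intro!: bounded_linear_Pair bounded_linear_ident bounded_linear_zero)
  have "Ck_on k S (\<lambda>x. (f x, 0) + (0, g x))"
    by (intro Ck_on_add Ck_on_bounded_linear_comp[OF l] Ck_on_bounded_linear_comp[OF r] assms)
  then show ?thesis by simp
qed

lemma Ck_on_scaleR:
  "Ck_on k S a \<Longrightarrow> Ck_on k S g \<Longrightarrow> Ck_on k S (\<lambda>x. a x *\<^sub>R g x)"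
proof (induction k arbitrary: a g)
  case 0 then show ?case by (auto intro: continuous_intros)
next
  case (Suc k)
  then obtain a' g' where a': "\<forall>x\<in>S. (a has_derivative a' x) (at x)" "\<forall>v. Ck_on k S (\<lambda>x. a' x v)"
    and g': "\<forall>x\<in>S. (g has_derivative g' x) (at x)" "\<forall>v. Ck_on k S (\<lambda>x. g' x v)"
    by auto
  have "Ck_on k S a" "Ck_on k S g" using Suc.prems by (blast intro: Ck_on_Suc_imp)+
  then show ?case
    unfolding Ck_on.simps
    by (intro exI[of _ "\<lambda>x v. a x *\<^sub>R g' x v + a' x v *\<^sub>R g x"])
      (use a' g' Suc.IH in \<open>auto intro!: Ck_on_add has_derivative_scaleR\<close>)
qed

text \<open>The middle space has to be finite-dimensional, because the derivatives in the recursive clause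
are continuous only along each fixed direction.\<close>

lemma Ck_on_compose:
  fixes f :: "'u::real_normed_vector \<Rightarrow> 'v::real_inner"
  assumes E: "coordinate_frame (E::'v set)"
  shows "Ck_on k S f \<Longrightarrow> Ck_on k T g \<Longrightarrow> f ` S \<subseteq> T \<Longrightarrow> Ck_on k S (\<lambda>x. g (f x))"
proof (induction k arbitrary: g)
  case 0 then show ?case by (auto intro: continuous_on_compose2)
next
  case (Suc k)
  then obtain f' g' where f': "\<forall>x\<in>S. (f has_derivative f' x) (at x)" "\<forall>v. Ck_on k S (\<lambda>x. f' x v)"
    and g': "\<forall>x\<in>T. (g has_derivative g' x) (at x)" "\<forall>v. Ck_on k T (\<lambda>x. g' x v)"
    by auto
  have fk: "Ck_on k S f" using Suc.prems by (blast intro: Ck_on_Suc_imp)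
  \<comment> \<open>The chain rule differentiates g along the direction f' x v, which moves with x.  Expanding it
    in a frame leaves only derivatives along fixed directions, to which the induction
    hypothesis applies.\<close>
  have "((\<lambda>x. g (f x)) has_derivative (\<lambda>v. \<Sum>b\<in>E. (f' x v \<bullet> b) *\<^sub>R g' (f x) b)) (at x)"
    if x: "x \<in> S" for x
  proof -
    have gx: "(g has_derivative g' (f x)) (at (f x))" using g' x Suc.prems by auto
    have "((\<lambda>x. g (f x)) has_derivative (\<lambda>v. g' (f x) (f' x v))) (at x)"
      using has_derivative_compose[of f "f' x" x UNIV g "g' (f x)"] f' x gx by auto
    moreover have "g' (f x) (f' x v) = (\<Sum>b\<in>E. (f' x v \<bullet> b) *\<^sub>R g' (f x) b)" for v
      by (rule linear_frame_expansion[OF E]) (use gx has_derivative_linear in blast)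
    ultimately show ?thesis by simp
  qed
  moreover have "Ck_on k S (\<lambda>x. \<Sum>b\<in>E. (f' x v \<bullet> b) *\<^sub>R g' (f x) b)" for v
  proof (intro Ck_on_sum Ck_on_scaleR)
    fix b
    show "Ck_on k S (\<lambda>x. f' x v \<bullet> b)"
      using f' by (intro Ck_on_bounded_linear_comp[OF bounded_linear_inner_left]) auto
    show "Ck_on k S (\<lambda>x. g' (f x) b)"
      using Suc.IH[OF fk] g'(2) Suc.prems(3) by blast
  qed
  ultimately show ?case
    unfolding Ck_on.simps
    by (intro exI[of _ "\<lambda>x v. \<Sum>b\<in>E. (f' x v \<bullet> b) *\<^sub>R g' (f x) b"]) simp
qed

lemma smooth_on_compose:
  fixes f :: "'u::real_normed_vector \<Rightarrow> 'v::real_inner"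
  assumes E: "coordinate_frame (E::'v set)" and f: "smooth_on S f" and g: "smooth_on T g"
  shows "smooth_on (S \<inter> f -` T) (\<lambda>x. g (f x))"
proof -
  have "continuous_on S f" using f unfolding smooth_on_def by (metis Ck_on.simps(1))
  then have o: "open (S \<inter> f -` T)"
    using f g by (simp add: smooth_on_def continuous_open_preimage)
  have "Ck_on k (S \<inter> f -` T) f" "Ck_on k T g" for k
    using f g by (auto simp: smooth_on_def intro: Ck_on_subset)
  then show ?thesis
    using o Ck_on_compose[OF E, of _ "S \<inter> f -` T" f T g] by (auto simp: smooth_on_def)
qed

lemma smooth_on_open: "smooth_on S f \<Longrightarrow> open S"
  by (simp add: smooth_on_def)

lemma smooth_on_cong:
  "smooth_on S f \<Longrightarrow> (\<And>x. x \<in> S \<Longrightarrow> f x = g x) \<Longrightarrow> smooth_on S g"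
  unfolding smooth_on_def using Ck_on_cong by blast

lemma smooth_on_subset: "smooth_on S f \<Longrightarrow> open T \<Longrightarrow> T \<subseteq> S \<Longrightarrow> smooth_on T f"
  unfolding smooth_on_def using Ck_on_subset by blast

lemma smooth_on_const: "open S \<Longrightarrow> smooth_on S (\<lambda>x. c)"
  by (simp add: smooth_on_def Ck_on_const)

lemma smooth_on_bounded_linear: "open S \<Longrightarrow> bounded_linear h \<Longrightarrow> smooth_on S h"
  by (simp add: smooth_on_def Ck_on_bounded_linear)

lemma smooth_on_Pair:
  assumes "smooth_on S f" "smooth_on T g"
  shows "smooth_on (S \<inter> T) (\<lambda>x. (f x, g x))"
  using assms unfolding smooth_on_def by (auto intro!: Ck_on_Pair intro: Ck_on_subset)

lemma smooth_on_local:
  assumes "\<And>x. x \<in> S \<Longrightarrow> \<exists>N. x \<in> N \<and> N \<subseteq> S \<and> smooth_on N f"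
  shows "smooth_on S f"
proof -
  have "open S"
    using assms smooth_on_open by (subst open_subopen) blast
  moreover have "Ck_on k S f" for k
    using Ck_on_local[OF \<open>open S\<close>] assms unfolding smooth_on_def by metis
  ultimately show ?thesis by (simp add: smooth_on_def)
qed

lemma smooth_on_differentiable:
  assumes "smooth_on S f" "x \<in> S"
  shows "(f has_derivative frechet_derivative f (at x)) (at x)"
proof -
  have "Ck_on (Suc 0) S f" using assms unfolding smooth_on_def by blast
  then show ?thesis
    using assms Ck_on_iff_frechet[of S 0 f] by (simp add: smooth_on_def frechet_derivative_works)
qed

lemma smooth_on_directional:
  assumes "smooth_on S f"
  shows "smooth_on S (\<lambda>x. frechet_derivative f (at x) v)"
  using assms Ck_on_iff_frechet unfolding smooth_on_def by blast

text \<open>The operator norm of the derivative is at most the sum of the norms of its values on a frame,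
weighted by the lengths of the frame vectors.  This sum is continuous, hence bounded near \<open>e\<close>, and
the mean value inequality on a ball applies.\<close>

lemma smooth_on_locally_lipschitz:
  fixes F :: "'v::real_inner \<Rightarrow> 'w::real_normed_vector"
  assumes E: "coordinate_frame (E::'v set)" and F: "smooth_on S F" and e: "e \<in> S"
  shows "\<exists>r>0. \<exists>K\<ge>0. cball e r \<subseteq> S \<and>
    (\<forall>x\<in>cball e r. \<forall>y\<in>cball e r. norm (F x - F y) \<le> K * norm (x - y))"
proof -
  let ?F' = "\<lambda>x. frechet_derivative F (at x)"
  let ?N = "\<lambda>x. \<Sum>b\<in>E. norm b * norm (?F' x b)"
  define K where "K = ?N e + 1"
  have "Ck_on 0 S (\<lambda>x. ?F' x b)" for b
    using smooth_on_directional[OF F] unfolding smooth_on_def by blast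
  then have "continuous_on S ?N" by (auto intro!: continuous_intros)
  then have "isCont ?N e"
    using smooth_on_open[OF F] e by (simp add: continuous_on_eq_continuous_at)
  then have "eventually (\<lambda>x. ?N x < K) (nhds e)"
    by (intro order_tendstoD(2)[of ?N "?N e"]) (auto simp: K_def continuous_at tendsto_nhds_iff)
  moreover have "eventually (\<lambda>x. x \<in> S) (nhds e)"
    using smooth_on_open[OF F] e by (rule eventually_nhds_in_open)
  ultimately have "eventually (\<lambda>x. ?N x < K \<and> x \<in> S) (nhds e)" by (rule eventually_conj)
  then obtain d where d: "d > 0" "\<And>x. dist x e < d \<Longrightarrow> ?N x < K \<and> x \<in> S"
    unfolding eventually_nhds_metric by auto
  have in_S: "x \<in> S" "?N x < K" if "x \<in> cball e (d/2)" for x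
  proof -
    have "dist x e < d" using that d(1) by (simp add: dist_commute)
    then show "x \<in> S" "?N x < K" using d(2) by auto
  qed
  have F'_le: "norm (?F' x v) \<le> K * norm v" if x: "x \<in> cball e (d/2)" for x v
  proof -
    have "linear (?F' x)" using smooth_on_differentiable[OF F in_S(1)[OF x]] has_derivative_linear by blast
    then have "norm (?F' x v) = norm (\<Sum>b\<in>E. (v \<bullet> b) *\<^sub>R ?F' x b)"
      using linear_frame_expansion[OF E] by metis
    also have "\<dots> \<le> (\<Sum>b\<in>E. norm v * (norm b * norm (?F' x b)))"
      by (intro sum_norm_le)
        (simp add: Cauchy_Schwarz_ineq2 mult_right_mono flip: mult.assoc)
    also have "\<dots> = norm v * ?N x" by (simp add: sum_distrib_left)
    also have "\<dots> \<le> norm v * K" using in_S(2)[OF x] by (intro mult_left_mono) auto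
    finally show "norm (?F' x v) \<le> K * norm v" by (simp add: mult.commute)
  qed
  have "onorm (?F' x) \<le> K" if "x \<in> cball e (d/2)" for x
    by (rule onorm_bound) (use F'_le that in \<open>auto simp: K_def intro!: add_nonneg_nonneg sum_nonneg\<close>)
  moreover have "(F has_derivative ?F' x) (at x within cball e (d/2))" if "x \<in> cball e (d/2)" for x
    using smooth_on_differentiable[OF F in_S(1)[OF that]] by (rule has_derivative_at_withinI)
  ultimately have "norm (F x - F y) \<le> K * norm (x - y)" if "x \<in> cball e (d/2)" "y \<in> cball e (d/2)" for x y
    using differentiable_bound[OF convex_cball, of e "d/2" F ?F' K x y] that by auto
  moreover have "K \<ge> 0" unfolding K_def by (intro add_nonneg_nonneg sum_nonneg) auto
  ultimately show ?thesis
    using d(1) in_S(1) by (intro exI[of _ "d/2"] conjI exI[of _ K]) auto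
qed

section \<open>Smooth maps between manifolds\<close>

text \<open>Composition of smooth maps uses only these two properties of an atlas.  They pass to products at
once, so products of manifolds need not be shown to be manifolds.\<close>

definition charted :: "'a topology \<Rightarrow> ('a, 'v) chart set \<Rightarrow> bool" where
  "charted X A \<longleftrightarrow> (\<forall>x\<in>topspace X. \<exists>(U, \<phi>)\<in>A. x \<in> U) \<and> (\<forall>(U, \<phi>)\<in>A. inj_on \<phi> U)"

lemma charted_inj: "charted X A \<Longrightarrow> (U, \<phi>) \<in> A \<Longrightarrow> inj_on \<phi> U"
  by (auto simp: charted_def)

lemma inv_into_chart: "charted X A \<Longrightarrow> (U, \<phi>) \<in> A \<Longrightarrow> x \<in> U \<Longrightarrow> inv_into U \<phi> (\<phi> x) = x"
  by (simp add: charted_inj)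

lemma map_prod_inj_on: "inj_on \<phi> U \<Longrightarrow> inj_on \<psi> V \<Longrightarrow> inj_on (map_prod \<phi> \<psi>) (U \<times> V)"
  by (auto simp: inj_on_def)

lemma charted_prod:
  assumes "charted X A" "charted Y B"
  shows "charted (prod_topology X Y) (prod_atlas A B)"
proof -
  have "\<exists>(N, \<theta>)\<in>prod_atlas A B. (x, y) \<in> N" if "x \<in> topspace X" "y \<in> topspace Y" for x y
  proof -
    obtain U \<phi> V \<psi> where "(U, \<phi>) \<in> A" "x \<in> U" "(V, \<psi>) \<in> B" "y \<in> V"
      using assms \<open>x \<in> topspace X\<close> \<open>y \<in> topspace Y\<close> unfolding charted_def by fast
    then have "(U \<times> V, map_prod \<phi> \<psi>) \<in> prod_atlas A B" "(x, y) \<in> U \<times> V"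
      by (auto simp: prod_atlas_def)
    then show ?thesis by (intro bexI[of _ "(U \<times> V, map_prod \<phi> \<psi>)"]) auto
  qed
  moreover have "inj_on \<theta> N" if "(N, \<theta>) \<in> prod_atlas A B" for N \<theta>
    using that assms by (auto simp: prod_atlas_def intro!: map_prod_inj_on dest: charted_inj)
  ultimately show ?thesis unfolding charted_def by (auto 0 2)
qed

lemma smooth_map_onD:
  assumes "smooth_map_on X A Y B W f" "(U, \<phi>) \<in> A" "(V, \<psi>) \<in> B"
  shows "smooth_on (\<phi> ` {x \<in> U \<inter> W. f x \<in> V}) (\<lambda>z. \<psi> (f (inv_into U \<phi> z)))"
  using assms by (auto simp: smooth_map_on_def o_def)

lemma smooth_map_onI:
  assumes "openin X W" "continuous_map (subtopology X W) Y f"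
    and "\<And>U \<phi> V \<psi>. (U, \<phi>) \<in> A \<Longrightarrow> (V, \<psi>) \<in> B \<Longrightarrow>
      smooth_on (\<phi> ` {x \<in> U \<inter> W. f x \<in> V}) (\<lambda>z. \<psi> (f (inv_into U \<phi> z)))"
  shows "smooth_map_on X A Y B W f"
  using assms by (auto simp: smooth_map_on_def o_def)

lemma smooth_map_on_openin: "smooth_map_on X A Y B W f \<Longrightarrow> openin X W"
  by (simp add: smooth_map_on_def)

lemma smooth_map_on_in_space:
  assumes "smooth_map_on X A Y B W f" "x \<in> W" shows "f x \<in> topspace Y"
proof -
  have "openin X W" "continuous_map (subtopology X W) Y f"
    using assms(1) by (simp_all add: smooth_map_on_def)
  then show ?thesis
    using continuous_map_image_subset_topspace[of "subtopology X W" Y f] openin_subset[of X W] assms(2)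
    by auto
qed

text \<open>Around each point the composite factors through a chart of the middle space at the image point,
where smoothness is that of a composite of maps between vector spaces; such local pieces cover
the domain.\<close>

lemma smooth_map_on_compose:
  fixes B :: "('b, 'w::real_inner) chart set"
  assumes E: "coordinate_frame (E::'w set)" and X: "charted X A" and Y: "charted Y B"
    and f: "smooth_map_on X A Y B W f" and g: "smooth_map_on Y B Z C W' g"
  shows "smooth_map_on X A Z C {x \<in> W. f x \<in> W'} (\<lambda>x. g (f x))"
proof (rule smooth_map_onI)
  have W: "openin X W" "W \<subseteq> topspace X" and W': "openin Y W'"
    and cf: "continuous_map (subtopology X W) Y f" and cg: "continuous_map (subtopology Y W') Z g"
    using f g by (auto simp: smooth_map_on_def openin_subset)
  have "openin (subtopology X W) {x \<in> topspace (subtopology X W). f x \<in> W'}"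
    by (rule openin_continuous_map_preimage[OF cf W'])
  then show "openin X {x \<in> W. f x \<in> W'}"
    using W by (simp add: openin_open_subtopology Int_absorb1)
  have "continuous_map (subtopology X {x \<in> W. f x \<in> W'}) Y f"
    using cf by (rule continuous_map_from_subtopology_mono) auto
  then have "continuous_map (subtopology X {x \<in> W. f x \<in> W'}) (subtopology Y W') f"
    by (auto simp: continuous_map_in_subtopology)
  from continuous_map_compose[OF this cg]
  show "continuous_map (subtopology X {x \<in> W. f x \<in> W'}) Z (\<lambda>x. g (f x))" by (simp add: o_def)
next
  fix U \<phi> V \<psi> assume U: "(U, \<phi>) \<in> A" and V: "(V, \<psi>) \<in> C"
  let ?S = "\<phi> ` {x \<in> U \<inter> {x \<in> W. f x \<in> W'}. g (f x) \<in> V}"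
  show "smooth_on ?S (\<lambda>z. \<psi> (g (f (inv_into U \<phi> z))))"
  proof (rule smooth_on_local)
    fix z assume "z \<in> ?S"
    then obtain x where x: "z = \<phi> x" "x \<in> U" "x \<in> W" "f x \<in> W'" "g (f x) \<in> V" by auto
    obtain N \<theta> where N: "(N, \<theta>) \<in> B" "f x \<in> N"
      using Y smooth_map_on_in_space[OF f x(3)] unfolding charted_def by fast
    let ?D = "\<phi> ` {x \<in> U \<inter> W. f x \<in> N}" and ?P = "\<lambda>z. \<theta> (f (inv_into U \<phi> z))"
    let ?T = "\<theta> ` {y \<in> N \<inter> W'. g y \<in> V}" and ?Q = "\<lambda>z. \<psi> (g (inv_into N \<theta> z))"
    have sm: "smooth_on (?D \<inter> ?P -` ?T) (\<lambda>z. ?Q (?P z))"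
      by (rule smooth_on_compose[OF E smooth_map_onD[OF f U N(1)] smooth_map_onD[OF g N(1) V]])
    note [simp] = inv_into_chart[OF X U] inv_into_chart[OF Y N(1)]
    have in_D: "\<exists>x'. z' = \<phi> x' \<and> x' \<in> U \<and> x' \<in> W \<and> f x' \<in> N \<and> f x' \<in> W' \<and> g (f x') \<in> V"
      if z': "z' \<in> ?D \<inter> ?P -` ?T" for z'
    proof -
      obtain x' where x': "z' = \<phi> x'" "x' \<in> U" "x' \<in> W" "f x' \<in> N" using z' by auto
      then obtain y where "\<theta> (f x') = \<theta> y" "y \<in> N" "y \<in> W'" "g y \<in> V" using z' by auto
      moreover from this have "f x' = y" using charted_inj[OF Y N(1)] x' by (auto dest: inj_onD)
      ultimately show ?thesis using x' by blast
    qed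
    have "smooth_on (?D \<inter> ?P -` ?T) (\<lambda>z. \<psi> (g (f (inv_into U \<phi> z))))"
    proof (rule smooth_on_cong[OF sm])
      fix z' assume "z' \<in> ?D \<inter> ?P -` ?T"
      from in_D[OF this] show "?Q (?P z') = \<psi> (g (f (inv_into U \<phi> z')))" by auto
    qed
    moreover have "z \<in> ?D \<inter> ?P -` ?T" using x N by auto
    moreover have "?D \<inter> ?P -` ?T \<subseteq> ?S"
    proof
      fix z' assume "z' \<in> ?D \<inter> ?P -` ?T"
      from in_D[OF this] show "z' \<in> ?S" by auto
    qed
    ultimately show "\<exists>N. z \<in> N \<and> N \<subseteq> ?S \<and> smooth_on N (\<lambda>z. \<psi> (g (f (inv_into U \<phi> z))))"
      by (intro exI[of _ "?D \<inter> ?P -` ?T"] conjI)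
  qed
qed

lemma smooth_map_on_Pair:
  assumes X: "charted X A"
    and f: "smooth_map_on X A Y B W f" and g: "smooth_map_on X A Z C W g"
  shows "smooth_map_on X A (prod_topology Y Z) (prod_atlas B C) W (\<lambda>x. (f x, g x))"
proof (rule smooth_map_onI)
  show "openin X W" "continuous_map (subtopology X W) (prod_topology Y Z) (\<lambda>x. (f x, g x))"
    using f g by (auto simp: smooth_map_on_def continuous_map_pairedI)
next
  fix U \<phi> N \<theta> assume U: "(U, \<phi>) \<in> A" and "(N, \<theta>) \<in> prod_atlas B C"
  then obtain V1 \<psi>1 V2 \<psi>2 where
    V: "(V1, \<psi>1) \<in> B" "(V2, \<psi>2) \<in> C" and N: "N = V1 \<times> V2" "\<theta> = map_prod \<psi>1 \<psi>2"
    by (auto simp: prod_atlas_def)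
  have "\<phi> ` {x \<in> U \<inter> W. (f x, g x) \<in> N} = \<phi> ` {x \<in> U \<inter> W. f x \<in> V1} \<inter> \<phi> ` {x \<in> U \<inter> W. g x \<in> V2}"
    unfolding N
    by (subst inj_on_image_Int[OF charted_inj[OF X U], symmetric]) auto
  then show "smooth_on (\<phi> ` {x \<in> U \<inter> W. (f x, g x) \<in> N})
      (\<lambda>z. \<theta> (f (inv_into U \<phi> z), g (inv_into U \<phi> z)))"
    using smooth_on_Pair[OF smooth_map_onD[OF f U V(1)] smooth_map_onD[OF g U V(2)]]
    by (simp add: N)
qed

section \<open>Smooth maps built from the group operations\<close>

context lie_group
begin

abbreviation "smooth_into_group X A W f \<equiv> smooth_map_on X A (topol G) (atlas G) W f"

lemma chart_openin: "(U, \<phi>) \<in> atlas G \<Longrightarrow> openin (topol G) U"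
  using manifold by (auto simp: smooth_manifold_def)

lemma chart_subset: "(U, \<phi>) \<in> atlas G \<Longrightarrow> U \<subseteq> carrier G"
  using openin_subset[OF chart_openin] topspace_eq by simp

lemma chart_homeomorphic:
  "(U, \<phi>) \<in> atlas G \<Longrightarrow> homeomorphic_map (subtopology (topol G) U) (top_of_set (\<phi> ` U)) \<phi>"
  using manifold by (auto simp: smooth_manifold_def)

lemma chart_range_open: "(U, \<phi>) \<in> atlas G \<Longrightarrow> open (\<phi> ` U)"
  using manifold by (auto simp: smooth_manifold_def)

lemma chart_transition:
  "(U, \<phi>) \<in> atlas G \<Longrightarrow> (V, \<psi>) \<in> atlas G \<Longrightarrow> smooth_on (\<phi> ` (U \<inter> V)) (\<lambda>z. \<psi> (inv_into U \<phi> z))"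
proof -
  have *: "\<forall>(U, \<phi>)\<in>atlas G. \<forall>(V, \<psi>)\<in>atlas G. smooth_on (\<phi> ` (U \<inter> V)) (\<psi> \<circ> inv_into U \<phi>)"
    using manifold by (simp add: smooth_manifold_def)
  assume "(U, \<phi>) \<in> atlas G" "(V, \<psi>) \<in> atlas G"
  with bspec[OF *, of "(U, \<phi>)"] show ?thesis by (auto simp: o_def dest: bspec)
qed

lemma Hausdorff: "Hausdorff_space (topol G)"
  using manifold by (simp add: smooth_manifold_def)

lemma model_frame: obtains E :: "'v set" where "coordinate_frame E"
proof -
  obtain D :: "'v set" where "finite D" "span D = UNIV"
    using manifold by (auto simp: smooth_manifold_def)
  then show thesis using coordinate_frame_exists that by blast
qed

lemma charted: "charted (topol G) (atlas G)"
proof -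
  have "inj_on \<phi> U" if "(U, \<phi>) \<in> atlas G" for U \<phi>
    using homeomorphic_imp_injective_map[OF chart_homeomorphic[OF that]] chart_openin[OF that]
    by (simp add: Int_absorb1 openin_subset)
  moreover have "(\<Union>(U, \<phi>)\<in>atlas G. U) = topspace (topol G)"
    using manifold by (simp add: smooth_manifold_def)
  then have "\<exists>(U, \<phi>)\<in>atlas G. x \<in> U" if "x \<in> topspace (topol G)" for x using that by auto
  ultimately show ?thesis by (auto simp: charted_def)
qed

lemma charted2: "charted (prod_topology (topol G) (topol G)) (prod_atlas (atlas G) (atlas G))"
  by (rule charted_prod[OF charted charted])

lemma chart_image_open:
  assumes "(U, \<phi>) \<in> atlas G" "openin (topol G) W" "W \<subseteq> U"
  shows "open (\<phi> ` W)"
proof -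
  have "openin (subtopology (topol G) U) W"
    using assms chart_openin[OF assms(1)] by (simp add: openin_open_subtopology)
  then have "openin (top_of_set (\<phi> ` U)) (\<phi> ` W)"
    using homeomorphic_imp_open_map[OF chart_homeomorphic[OF assms(1)]] by (simp add: open_map_def)
  then show ?thesis using chart_range_open[OF assms(1)] openin_open_trans by blast
qed

lemma smooth_id: "smooth_into_group (topol G) (atlas G) (carrier G) (\<lambda>x. x)"
proof (rule smooth_map_onI)
  show "openin (topol G) (carrier G)" using topspace_eq by (metis openin_topspace)
  fix U \<phi> V \<psi> assume "(U, \<phi>) \<in> atlas G" "(V, \<psi>) \<in> atlas G"
  moreover from this have "{x \<in> U \<inter> carrier G. x \<in> V} = U \<inter> V" using chart_subset by blast
  ultimately show "smooth_on (\<phi> ` {x \<in> U \<inter> carrier G. x \<in> V}) (\<lambda>z. \<psi> (inv_into U \<phi> z))"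
    using chart_transition by simp
qed (simp add: continuous_map_from_subtopology)

lemma smooth_const:
  assumes "c \<in> carrier G" shows "smooth_into_group (topol G) (atlas G) (carrier G) (\<lambda>x. c)"
proof (rule smooth_map_onI)
  show op: "openin (topol G) (carrier G)" using topspace_eq by (metis openin_topspace)
  fix U \<phi> V \<psi> assume U: "(U, \<phi>) \<in> atlas G"
  have "{x \<in> U \<inter> carrier G. c \<in> V} = (if c \<in> V then U else {})" using chart_subset[OF U] by auto
  then show "smooth_on (\<phi> ` {x \<in> U \<inter> carrier G. c \<in> V}) (\<lambda>z. \<psi> c)"
    using chart_range_open[OF U] by (auto intro: smooth_on_const)
qed (use assms topspace_eq in simp)

lemma smooth_compose_into:
  assumes "charted X A" "smooth_into_group X A W f"
    and "smooth_map_on (topol G) (atlas G) Z C (carrier G) h"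
  shows "smooth_map_on X A Z C W (\<lambda>x. h (f x))"
proof -
  obtain E :: "'v set" where E: "coordinate_frame E" by (rule model_frame)
  have "{x \<in> W. f x \<in> carrier G} = W" using smooth_map_on_in_space[OF assms(2)] topspace_eq by auto
  then show ?thesis using smooth_map_on_compose[OF E assms(1) charted assms(2,3)] by simp
qed

lemma smooth_inv_comp:
  "charted X A \<Longrightarrow> smooth_into_group X A W f \<Longrightarrow> smooth_into_group X A W (\<lambda>x. inv f x)"
  by (rule smooth_compose_into[OF _ _ smooth_inv])

lemma smooth_mult_comp:
  assumes "charted X A" "smooth_into_group X A W f" "smooth_into_group X A W g"
  shows "smooth_into_group X A W (\<lambda>x. f x \<otimes> g x)"
proof -
  obtain E :: "'v set" where E: "coordinate_frame E" by (rule model_frame)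
  then obtain P :: "('v \<times> 'v) set" where P: "coordinate_frame P" using coordinate_frame_prod by blast
  have "{x \<in> W. (f x, g x) \<in> carrier G \<times> carrier G} = W"
    using smooth_map_on_in_space[OF assms(2)] smooth_map_on_in_space[OF assms(3)] topspace_eq by auto
  then show ?thesis
    using smooth_map_on_compose[OF P assms(1) charted2 smooth_map_on_Pair[OF assms] smooth_mult] by simp
qed

text \<open>With constants, inversion and multiplication, the projections make every group word in two
variables a smooth map on \<open>G \<times> G\<close>.\<close>

lemma smooth_proj:
  "smooth_into_group (prod_topology (topol G) (topol G)) (prod_atlas (atlas G) (atlas G))
     (carrier G \<times> carrier G) fst" (is "?P fst")
  "smooth_into_group (prod_topology (topol G) (topol G)) (prod_atlas (atlas G) (atlas G))
     (carrier G \<times> carrier G) snd"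
proof -
  obtain E :: "'v set" where E: "coordinate_frame E" by (rule model_frame)
  have op: "openin (prod_topology (topol G) (topol G)) (carrier G \<times> carrier G)"
    using topspace_eq openin_topspace[of "prod_topology (topol G) (topol G)"] by simp
  have charts: "\<phi> ` (U \<inter> V) \<times> \<phi>' ` U' = map_prod \<phi> \<phi>' ` {p \<in> (U \<times> U') \<inter> carrier G \<times> carrier G. fst p \<in> V}"
     "\<phi> ` U \<times> \<phi>' ` (U' \<inter> V) = map_prod \<phi> \<phi>' ` {p \<in> (U \<times> U') \<inter> carrier G \<times> carrier G. snd p \<in> V}"
    if "(U, \<phi>) \<in> atlas G" "(U', \<phi>') \<in> atlas G" for U \<phi> U' \<phi>' V
  proof -
    have "{p \<in> (U \<times> U') \<inter> carrier G \<times> carrier G. fst p \<in> V} = (U \<inter> V) \<times> U'"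
      "{p \<in> (U \<times> U') \<inter> carrier G \<times> carrier G. snd p \<in> V} = U \<times> (U' \<inter> V)"
      using that chart_subset by fastforce+
    then show "\<phi> ` (U \<inter> V) \<times> \<phi>' ` U' = map_prod \<phi> \<phi>' ` {p \<in> (U \<times> U') \<inter> carrier G \<times> carrier G. fst p \<in> V}"
     "\<phi> ` U \<times> \<phi>' ` (U' \<inter> V) = map_prod \<phi> \<phi>' ` {p \<in> (U \<times> U') \<inter> carrier G \<times> carrier G. snd p \<in> V}"
      by (simp_all add: map_prod_surj_on)
  qed
  have inv: "inv_into (U \<times> U') (map_prod \<phi> \<phi>') (\<phi> x, \<phi>' y) = (x, y)"
    if "(U, \<phi>) \<in> atlas G" "(U', \<phi>') \<in> atlas G" "x \<in> U" "y \<in> U'" for U \<phi> U' \<phi>' x y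
    using inv_into_f_f[OF map_prod_inj_on[OF charted_inj[OF charted that(1)] charted_inj[OF charted that(2)]], of "(x, y)"]
      that by simp
  show "?P fst"
  proof (rule smooth_map_onI[OF op])
    fix N \<theta> V \<psi> assume "(N, \<theta>) \<in> prod_atlas (atlas G) (atlas G)" and V: "(V, \<psi>) \<in> atlas G"
    then obtain U \<phi> U' \<phi>' where U: "(U, \<phi>) \<in> atlas G" "(U', \<phi>') \<in> atlas G"
      and N: "N = U \<times> U'" "\<theta> = map_prod \<phi> \<phi>'" by (auto simp: prod_atlas_def)
    have "smooth_on (UNIV \<inter> fst -` (\<phi> ` (U \<inter> V))) (\<lambda>z::'v\<times>'v. \<psi> (inv_into U \<phi> (fst z)))"
      by (rule smooth_on_compose[OF E smooth_on_bounded_linear[OF open_UNIV bounded_linear_fst] chart_transition[OF U(1) V]])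
    moreover have "open (\<phi> ` (U \<inter> V) \<times> \<phi>' ` U')"
      using chart_image_open[OF U(1), of "U \<inter> V"] chart_range_open[OF U(2)] chart_openin U(1) V
      by (intro open_Times) (auto intro: openin_Int)
    ultimately have "smooth_on (\<phi> ` (U \<inter> V) \<times> \<phi>' ` U') (\<lambda>z. \<psi> (inv_into U \<phi> (fst z)))"
      by (rule smooth_on_subset) auto
    then have "smooth_on (\<phi> ` (U \<inter> V) \<times> \<phi>' ` U') (\<lambda>z. \<psi> (fst (inv_into N \<theta> z)))"
      by (rule smooth_on_cong) (auto simp: N inv[OF U] inv_into_chart[OF charted U(1)])
    then show "smooth_on (\<theta> ` {p \<in> N \<inter> carrier G \<times> carrier G. fst p \<in> V}) (\<lambda>z. \<psi> (fst (inv_into N \<theta> z)))"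
      unfolding charts[OF U] N .
  qed (simp add: continuous_map_from_subtopology continuous_map_fst)
  show "?P snd"
  proof (rule smooth_map_onI[OF op])
    fix N \<theta> V \<psi> assume "(N, \<theta>) \<in> prod_atlas (atlas G) (atlas G)" and V: "(V, \<psi>) \<in> atlas G"
    then obtain U \<phi> U' \<phi>' where U: "(U, \<phi>) \<in> atlas G" "(U', \<phi>') \<in> atlas G"
      and N: "N = U \<times> U'" "\<theta> = map_prod \<phi> \<phi>'" by (auto simp: prod_atlas_def)
    have "smooth_on (UNIV \<inter> snd -` (\<phi>' ` (U' \<inter> V))) (\<lambda>z::'v\<times>'v. \<psi> (inv_into U' \<phi>' (snd z)))"
      by (rule smooth_on_compose[OF E smooth_on_bounded_linear[OF open_UNIV bounded_linear_snd] chart_transition[OF U(2) V]])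
    moreover have "open (\<phi> ` U \<times> \<phi>' ` (U' \<inter> V))"
      using chart_image_open[OF U(2), of "U' \<inter> V"] chart_range_open[OF U(1)] chart_openin U(2) V
      by (intro open_Times) (auto intro: openin_Int)
    ultimately have "smooth_on (\<phi> ` U \<times> \<phi>' ` (U' \<inter> V)) (\<lambda>z. \<psi> (inv_into U' \<phi>' (snd z)))"
      by (rule smooth_on_subset) auto
    then have "smooth_on (\<phi> ` U \<times> \<phi>' ` (U' \<inter> V)) (\<lambda>z. \<psi> (snd (inv_into N \<theta> z)))"
      by (rule smooth_on_cong) (auto simp: N inv[OF U] inv_into_chart[OF charted U(2)])
    then show "smooth_on (\<theta> ` {p \<in> N \<inter> carrier G \<times> carrier G. snd p \<in> V}) (\<lambda>z. \<psi> (snd (inv_into N \<theta> z)))"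
      unfolding charts[OF U] N .
  qed (simp add: continuous_map_from_subtopology continuous_map_snd)
qed

lemma smooth_left_mult: "a \<in> carrier G \<Longrightarrow> smooth_into_group (topol G) (atlas G) (carrier G) (\<lambda>x. a \<otimes> x)"
  by (intro smooth_mult_comp charted smooth_const smooth_id)

lemma smooth_conj:
  "g \<in> carrier G \<Longrightarrow> smooth_into_group (topol G) (atlas G) (carrier G) (\<lambda>x. g \<otimes> x \<otimes> inv g)"
  by (intro smooth_mult_comp charted smooth_const smooth_id inv_closed)

end

section \<open>Velocities of curves in a chart\<close>

text \<open>The curve \<open>x\<close> passes at time \<open>0\<close> through the chart domain with coordinate velocity \<open>v\<close>.  A chart is
arbitrary outside its domain, so the curve is required to stay in the domain for a short time.\<close>

definition moves :: "'a set \<Rightarrow> ('a \<Rightarrow> 'v::real_normed_vector) \<Rightarrow> (real \<Rightarrow> 'a) \<Rightarrow> 'v \<Rightarrow> bool" where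
  "moves U \<phi> x v \<longleftrightarrow>
     (\<forall>\<^sub>F h in nhds 0. x h \<in> U) \<and> ((\<lambda>h. \<phi> (x h)) has_vector_derivative v) (at 0)"

lemma moves_start: "moves U \<phi> x v \<Longrightarrow> x 0 \<in> U"
  by (auto simp: moves_def dest: eventually_nhds_x_imp_x)

lemma moves_unique: "moves U \<phi> x v \<Longrightarrow> moves U \<phi> x w \<Longrightarrow> v = w"
  by (auto simp: moves_def dest: vector_derivative_unique_at)

lemma moves_cong:
  assumes "moves U \<phi> x v" "\<forall>\<^sub>F h in nhds 0. x h = y h"
  shows "moves U \<phi> y v"
proof -
  have "\<forall>\<^sub>F h in nhds 0. x h \<in> U" using assms(1) by (simp add: moves_def)
  with assms(2) have "\<forall>\<^sub>F h in nhds 0. y h \<in> U" by eventually_elim simp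
  moreover have "((\<lambda>h. \<phi> (y h)) has_vector_derivative v) (at 0)"
  proof -
    have 1: "\<forall>\<^sub>F h in at 0. \<phi> (x h) = \<phi> (y h)"
      unfolding eventually_at_filter by (rule eventually_mono[OF assms(2)]) simp
    have 2: "\<phi> (x 0) = \<phi> (y 0)" using eventually_nhds_x_imp_x[OF assms(2)] by simp
    have 3: "((\<lambda>h. \<phi> (x h)) has_derivative (\<lambda>h. h *\<^sub>R v)) (at 0)"
      using assms(1) by (simp only: moves_def has_vector_derivative_def)
    show ?thesis
      unfolding has_vector_derivative_def
      by (rule has_derivative_transform_eventually[where f = "\<lambda>h. \<phi> (x h)"]) (fact 3 1 2 UNIV_I)+
  qed
  ultimately show ?thesis by (simp add: moves_def)
qed

lemma moves_const: "p \<in> U \<Longrightarrow> moves U \<phi> (\<lambda>h. p) 0"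
  by (simp add: moves_def)

lemma moves_Pair:
  assumes "moves U \<phi> x v" "moves V \<psi> y w"
  shows "moves (U \<times> V) (map_prod \<phi> \<psi>) (\<lambda>h. (x h, y h)) (v, w)"
proof -
  have "\<forall>\<^sub>F h in nhds 0. x h \<in> U" "\<forall>\<^sub>F h in nhds 0. y h \<in> V"
    using assms by (simp_all add: moves_def)
  then have "\<forall>\<^sub>F h in nhds 0. (x h, y h) \<in> U \<times> V" by eventually_elim simp
  moreover have "((\<lambda>h. (\<phi> (x h), \<psi> (y h))) has_derivative (\<lambda>h. (h *\<^sub>R v, h *\<^sub>R w))) (at 0)"
    using assms by (intro has_derivative_Pair) (simp_all add: moves_def has_vector_derivative_def)
  ultimately show ?thesis by (simp add: moves_def has_vector_derivative_def)
qed

lemma moves_shift: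
  assumes "moves U \<phi> (\<lambda>h. x (t + h)) v"
  shows "((\<lambda>s. \<phi> (x s)) has_vector_derivative v) (at t)"
proof -
  have "((\<lambda>s. s - t) has_derivative (\<lambda>h. h)) (at t)" by (auto intro!: derivative_eq_intros)
  moreover have "((\<lambda>h. \<phi> (x (t + h))) has_derivative (\<lambda>h. h *\<^sub>R v)) (at (t - t))"
    using assms by (simp add: moves_def has_vector_derivative_def)
  ultimately show ?thesis
    using has_derivative_compose[of "\<lambda>s. s - t" _ t UNIV "\<lambda>h. \<phi> (x (t + h))"]
    by (simp add: has_vector_derivative_def)
qed

text \<open>The chain rule.  The new velocity depends on the curve only through its starting point and
its velocity; comparing two curves with the same data is used below to compute derivatives.\<close>

lemma moves_image:
  assumes X: "charted X A" "(U, \<phi>) \<in> A" and f: "smooth_map_on X A Y B W f"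
    and x: "moves U \<phi> x v" "x 0 \<in> W" and V: "(V, \<psi>) \<in> B" "f (x 0) \<in> V"
  shows "moves V \<psi> (\<lambda>h. f (x h))
    (frechet_derivative (\<lambda>z. \<psi> (f (inv_into U \<phi> z))) (at (\<phi> (x 0))) v)"
proof -
  let ?S = "\<phi> ` {x \<in> U \<inter> W. f x \<in> V}" and ?q = "\<lambda>z. \<psi> (f (inv_into U \<phi> z))"
  let ?D = "frechet_derivative ?q (at (\<phi> (x 0)))"
  note [simp] = inv_into_chart[OF X]
  have sm: "smooth_on ?S ?q" by (rule smooth_map_onD[OF f X(2) V(1)])
  have x0: "\<phi> (x 0) \<in> ?S" using moves_start[OF x(1)] x(2) V(2) by auto
  have D: "(?q has_derivative ?D) (at (\<phi> (x 0)))" by (rule smooth_on_differentiable[OF sm x0])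
  have x': "((\<lambda>h. \<phi> (x h)) has_derivative (\<lambda>h. h *\<^sub>R v)) (at 0)"
    using x(1) by (simp add: moves_def has_vector_derivative_def)
  have "((\<lambda>h. \<phi> (x h)) \<longlongrightarrow> \<phi> (x 0)) (nhds 0)"
    using has_derivative_continuous[OF x'] by (simp add: continuous_at tendsto_nhds_iff)
  then have "\<forall>\<^sub>F h in nhds 0. \<phi> (x h) \<in> ?S"
    using smooth_on_open[OF sm] x0 by (simp add: topological_tendstoD)
  moreover have "\<forall>\<^sub>F h in nhds 0. x h \<in> U" using x(1) by (simp add: moves_def)
  ultimately have ev: "\<forall>\<^sub>F h in nhds 0. x h \<in> U \<and> f (x h) \<in> V"
  proof eventually_elim
    case (elim h)
    then obtain y where "\<phi> (x h) = \<phi> y" "y \<in> U" "f y \<in> V" by auto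
    with elim show ?case using charted_inj[OF X] by (metis inj_onD)
  qed
  have "((\<lambda>h. ?q (\<phi> (x h))) has_derivative (\<lambda>h. ?D (h *\<^sub>R v))) (at 0)"
    using has_derivative_compose[OF x' D] .
  then have "((\<lambda>h. ?q (\<phi> (x h))) has_vector_derivative ?D v) (at 0)"
    using linear_scale[OF has_derivative_linear[OF D]] by (simp add: has_vector_derivative_def)
  then have "moves UNIV \<psi> (\<lambda>h. f (inv_into U \<phi> (\<phi> (x h)))) (?D v)" by (simp add: moves_def)
  then have "moves UNIV \<psi> (\<lambda>h. f (x h)) (?D v)"
    by (rule moves_cong) (rule eventually_mono[OF ev], simp)
  moreover have "\<forall>\<^sub>F h in nhds 0. f (x h) \<in> V" by (rule eventually_mono[OF ev]) simp
  ultimately show ?thesis by (simp add: moves_def)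
qed

locale lie_group_chart = lie_group G
  for G :: "('a, 'v::real_inner) smooth_group" (structure) +
  fixes U :: "'a set" and \<phi> :: "'a \<Rightarrow> 'v"
  assumes chart: "(U, \<phi>) \<in> atlas G" and one_in_chart: "\<one> \<in> U"
begin

lemma U_carrier: "x \<in> U \<Longrightarrow> x \<in> carrier G"
  using chart_subset[OF chart] by auto

lemma chart_inv [simp]: "x \<in> U \<Longrightarrow> inv_into U \<phi> (\<phi> x) = x"
  by (rule inv_into_chart[OF charted chart])

lemma chart_prod: "(U \<times> U, map_prod \<phi> \<phi>) \<in> prod_atlas (atlas G) (atlas G)"
  using chart by (auto simp: prod_atlas_def)

text \<open>The simplest curve through the identity with a prescribed velocity; it realises every coordinate
vector as a velocity.\<close>

definition line :: "'v \<Rightarrow> real \<Rightarrow> 'a" where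
  "line v t = inv_into U \<phi> (\<phi> \<one> + t *\<^sub>R v)"

lemma line_0 [simp]: "line v 0 = \<one>"
  by (simp add: line_def one_in_chart)

lemma line_moves: "moves U \<phi> (line v) v"
proof -
  have "((\<lambda>t. \<phi> \<one> + t *\<^sub>R v) \<longlongrightarrow> \<phi> \<one> + 0 *\<^sub>R v) (nhds 0)"
    by (intro tendsto_intros filterlim_ident)
  then have "\<forall>\<^sub>F t in nhds 0. \<phi> \<one> + t *\<^sub>R v \<in> \<phi> ` U"
    using chart_range_open[OF chart] one_in_chart by (auto dest!: topological_tendstoD[of _ _ _ "\<phi> ` U"])
  then have ev: "\<forall>\<^sub>F t in nhds 0. line v t \<in> U \<and> \<phi> (line v t) = \<phi> \<one> + t *\<^sub>R v"
    by (rule eventually_mono) (auto simp: line_def f_inv_into_f inv_into_into)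
  have "((\<lambda>t. \<phi> \<one> + t *\<^sub>R v) has_vector_derivative v) (at 0)"
    by (auto intro!: derivative_eq_intros)
  then have "moves UNIV id (\<lambda>t. \<phi> \<one> + t *\<^sub>R v) v" by (simp add: moves_def)
  then have "moves UNIV id (\<lambda>t. \<phi> (line v t)) v"
    by (rule moves_cong) (rule eventually_mono[OF ev], simp)
  moreover have "\<forall>\<^sub>F h in nhds 0. line v h \<in> U" by (rule eventually_mono[OF ev]) simp
  ultimately show ?thesis by (simp add: moves_def)
qed

text \<open>The left logarithmic derivative of a curve, that is, its velocity translated back to the identity.
Constancy of it is the differential equation of one-parameter subgroups.  In this form the
equation is visibly invariant under left translations and time shifts, and it makes sense for
curves that leave the chart.\<close>

definition body_velocity :: "(real \<Rightarrow> 'a) \<Rightarrow> real \<Rightarrow> 'v \<Rightarrow> bool" where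
  "body_velocity c t v \<longleftrightarrow> moves U \<phi> (\<lambda>h. inv (c t) \<otimes> c (t + h)) v"

lemma mult_inv_cancel: "x \<in> carrier G \<Longrightarrow> y \<in> carrier G \<Longrightarrow> x \<otimes> (inv x \<otimes> y) = y"
  by (simp add: m_assoc[symmetric])

lemma inv_mult_cancel: "x \<in> carrier G \<Longrightarrow> y \<in> carrier G \<Longrightarrow> inv x \<otimes> (x \<otimes> y) = y"
  by (simp add: m_assoc[symmetric])

text \<open>If \<open>c\<close> and \<open>d\<close> have the same body velocity, then \<open>c d\<inverse>\<close> has derivative zero, because the velocities
of the two factors cancel; so it is locally constant, hence constant on a connected
set.  The quotient is differentiated as the smooth function \<open>K\<close> below of the two translated curves.\<close>

lemma body_velocity_unique_curve:
  fixes I :: "real set"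
  assumes I: "open I" "connected I" "t0 \<in> I" "t1 \<in> I"
    and c: "\<And>t. t \<in> I \<Longrightarrow> c t \<in> carrier G" "\<And>t. t \<in> I \<Longrightarrow> body_velocity c t v"
    and d: "\<And>t. t \<in> I \<Longrightarrow> d t \<in> carrier G" "\<And>t. t \<in> I \<Longrightarrow> body_velocity d t v"
    and eq: "c t0 = d t0"
  shows "c t1 = d t1"
proof -
  define q where "q t = c t \<otimes> inv (d t)" for t
  have q: "q t \<in> carrier G" if "t \<in> I" for t using that c(1) d(1) by (simp add: q_def)
  have "\<forall>\<^sub>F b in at a within I. q a = q b" if a: "a \<in> I" for a
  proof -
    \<comment> \<open>Translating by the value at a brings q into the chart at the identity.\<close>
    define r where "r t = inv (q a) \<otimes> q t" for t
    have r: "r t \<in> carrier G" if "t \<in> I" for t using that a q by (simp add: r_def)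
    have r': "moves U \<phi> (\<lambda>h. r (t + h)) 0" if t: "t \<in> I" "r t \<in> U" for t
    proof -
      define K where "K p = inv (q a) \<otimes> c t \<otimes> fst p \<otimes> inv (snd p) \<otimes> inv (d t)" for p
      have K: "smooth_into_group (prod_topology (topol G) (topol G)) (prod_atlas (atlas G) (atlas G))
          (carrier G \<times> carrier G) K"
        unfolding K_def
        by (intro smooth_mult_comp smooth_inv_comp charted2 smooth_proj
            smooth_compose_into[OF charted2 smooth_proj(1) smooth_const])
          (use a t q c(1) d(1) in auto)
      have K1: "K (\<one>, \<one>) = r t" using a t q c(1) d(1) by (simp add: K_def r_def q_def m_assoc)
      let ?D = "frechet_derivative (\<lambda>z. \<phi> (K (inv_into (U \<times> U) (map_prod \<phi> \<phi>) z))) (at (\<phi> \<one>, \<phi> \<one>))"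
      have K': "moves U \<phi> (\<lambda>h. K (x h, y h)) (?D (v, v))"
        if "moves U \<phi> x v" "moves U \<phi> y v" "x 0 = \<one>" "y 0 = \<one>" for x y
        using moves_image[OF charted2 chart_prod K moves_Pair[OF that(1,2)] _ chart] that(3,4) K1 t(2)
        by simp
      \<comment> \<open>On the diagonal K is constant, so its derivative kills (v, v).\<close>
      have "\<forall>\<^sub>F h in nhds 0. K (line v h, line v h) = r t"
        using line_moves[of v] unfolding moves_def
      proof (elim conjE eventually_mono)
        fix h assume "line v h \<in> U"
        then have "line v h \<in> carrier G" by (rule U_carrier)
        then show "K (line v h, line v h) = r t" unfolding K1[symmetric]
          using a t q c(1) d(1) by (simp add: K_def m_assoc mult_inv_cancel)
      qed
      then have "moves U \<phi> (\<lambda>h. r t) (?D (v, v))"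
        using moves_cong[OF K'[OF line_moves line_moves]] by simp
      then have D0: "?D (v, v) = 0" using moves_unique moves_const[OF t(2)] by blast
      have A: "moves U \<phi> (\<lambda>h. K (inv (c t) \<otimes> c (t + h), inv (d t) \<otimes> d (t + h))) (?D (v, v))"
        by (rule K') (use c d t in \<open>auto simp: body_velocity_def\<close>)
      have B: "\<forall>\<^sub>F h in nhds 0. K (inv (c t) \<otimes> c (t + h), inv (d t) \<otimes> d (t + h)) = r (t + h)"
      proof -
        have "((\<lambda>h. t + h) \<longlongrightarrow> t + 0) (nhds 0)" by (intro tendsto_intros filterlim_ident)
        then have "\<forall>\<^sub>F h in nhds 0. t + h \<in> I" using I(1) t(1) by (auto dest: topological_tendstoD)
        then show ?thesis
        proof eventually_elim
          case (elim h)
          then show ?case using a t q c(1) d(1)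
            by (simp add: K_def r_def q_def m_assoc mult_inv_cancel inv_mult_cancel inv_mult_group)
        qed
      qed
      show ?thesis using moves_cong[OF A B] D0 by simp
    qed
    have ra: "r a = \<one>" using q a by (simp add: r_def)
    then have "moves U \<phi> (\<lambda>h. r (a + h)) 0" using r' a one_in_chart by simp
    then have "\<forall>\<^sub>F h in nhds 0. r (a + h) \<in> U" by (simp add: moves_def)
    then obtain e1 where e1: "e1 > 0" "\<And>h. dist h 0 < e1 \<Longrightarrow> r (a + h) \<in> U"
      unfolding eventually_nhds_metric by auto
    obtain e2 where e2: "e2 > 0" "ball a e2 \<subseteq> I" using I(1) a openE by blast
    define e where "e = min e1 e2"
    have e: "e > 0" using e1 e2 by (simp add: e_def)
    have inU: "r b \<in> U" "b \<in> I" if "b \<in> ball a e" for b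
      using e1(2)[of "b - a"] e2(2) that by (auto simp: e_def dist_real_def abs_minus_commute)
    have const: "\<phi> (r b) = \<phi> (r a)" if b: "b \<in> ball a e" for b
    proof (rule has_derivative_zero_unique[OF convex_ball _ b])
      show "a \<in> ball a e" using e by simp
      fix t assume "t \<in> ball a e"
      then have "((\<lambda>s. \<phi> (r s)) has_vector_derivative 0) (at t)"
        using moves_shift[OF r'] inU by blast
      then show "((\<lambda>s. \<phi> (r s)) has_derivative (\<lambda>h. 0)) (at t within ball a e)"
        by (simp add: has_vector_derivative_def has_derivative_at_withinI)
    qed
    have "r b = \<one>" if "b \<in> ball a e" for b
      using chart_inv[OF inU(1)[OF that]] chart_inv[OF one_in_chart] const[OF that] ra by metis
    then have "q a = q b" if "b \<in> ball a e" for b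
      using that inU(2)[OF that] q a mult_inv_cancel[of "q a" "q b"] by (simp add: r_def)
    then show ?thesis
      unfolding eventually_at using e by (intro exI[of _ e]) (auto simp: dist_commute)
  qed
  then have "q t0 = q t1" using connected_local_const[OF I(2,3,4), of q] by simp
  then have "q t1 = \<one>" using I c(1) d(1) by (simp add: q_def eq)
  then show ?thesis using inv_equality[of "c t1" "inv (d t1)"] I c(1) d(1) by (simp add: q_def)
qed

end

section \<open>Existence of integral curves\<close>

text \<open>Picard iteration on bounded continuous functions on the real line.  The interval is so short that
the integral operator preserves the ball and contracts by one half; the two integrals, from the
left end point to the clipped time and to \<open>0\<close>, account for the doubled terms in the estimates.\<close>

lemma picard_local:
  fixes F :: "'b::banach \<Rightarrow> 'b"
  assumes r: "r > 0" and K: "K \<ge> 0"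
    and lip: "\<And>x y. x \<in> cball e r \<Longrightarrow> y \<in> cball e r \<Longrightarrow> norm (F x - F y) \<le> K * norm (x - y)"
  shows "\<exists>\<epsilon>>0. \<exists>\<gamma>. \<gamma> 0 = e \<and>
    (\<forall>t. \<bar>t\<bar> < \<epsilon> \<longrightarrow> \<gamma> t \<in> cball e r \<and> (\<gamma> has_vector_derivative F (\<gamma> t)) (at t))"
proof -
  define M where "M = norm (F e) + K * r"
  have M: "norm (F x) \<le> M" if "x \<in> cball e r" for x
  proof -
    have "norm (F x) \<le> norm (F e) + norm (F x - F e)" by (rule norm_triangle_sub)
    also have "norm (F x - F e) \<le> K * norm (x - e)" by (rule lip) (use r that in auto)
    also have "\<dots> \<le> K * r" using that K by (intro mult_left_mono) (auto simp: dist_norm norm_minus_commute)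
    finally show ?thesis by (simp add: M_def)
  qed
  have M0: "M \<ge> 0" using r K by (simp add: M_def)
  define \<epsilon> where "\<epsilon> = min (r / (4 * (M + 1))) (1 / (8 * (K + 1)))"
  have \<epsilon>: "\<epsilon> > 0" using r M0 K by (simp add: \<epsilon>_def)
  have "\<epsilon> * (4 * (M + 1)) \<le> r" using M0 by (simp add: \<epsilon>_def pos_le_divide_eq[symmetric])
  then have \<epsilon>M: "M * (2 * \<epsilon>) + M * (2 * \<epsilon>) \<le> r" using \<epsilon> by (simp add: algebra_simps)
  have "\<epsilon> * (8 * (K + 1)) \<le> 1" using K by (simp add: \<epsilon>_def pos_le_divide_eq[symmetric])
  then have \<epsilon>K: "K * (2 * \<epsilon>) + K * (2 * \<epsilon>) \<le> 1 / 2" using \<epsilon> by (simp add: algebra_simps)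
  have F_cont: "continuous_on (cball e r) F"
  proof (rule continuous_onI)
    fix x d assume x: "x \<in> cball e r" and d: "(0::real) < d"
    have "dist (F y) (F x) \<le> d" if "y \<in> cball e r" "dist y x < d / (K + 1)" for y
    proof -
      have "dist (F y) (F x) \<le> K * dist y x" using lip[OF that(1) x] by (simp add: dist_norm)
      also have "\<dots> \<le> (K + 1) * (d / (K + 1))" using K that(2) by (intro mult_mono) auto
      finally show ?thesis using K by simp
    qed
    then show "\<exists>\<delta>>0. \<forall>y\<in>cball e r. dist y x < \<delta> \<longrightarrow> dist (F y) (F x) \<le> d"
      using d K by (intro exI[of _ "d / (K + 1)"]) auto
  qed
  define S where "S = {f :: real \<Rightarrow>\<^sub>C 'b. \<forall>t. f t \<in> cball e r}"
  have "S = PiC UNIV (\<lambda>_. cball e r)" by (simp add: S_def set_eq_iff mem_PiC_iff Pi_iff)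
  then have "complete S" by (simp add: closed_PiC complete_eq_closed)
  have F_comp: "continuous_on A (\<lambda>s. F (apply_bcontfun f s))" if "f \<in> S" for f :: "real \<Rightarrow>\<^sub>C 'b" and A
    using that by (intro continuous_on_compose2[OF F_cont]) (auto simp: S_def)
  \<comment> \<open>Freezing the time outside the interval lets the fixed point live on the whole line.\<close>
  define clip where "clip t = max (- \<epsilon>) (min \<epsilon> t)" for t :: real
  have clip: "clip t \<in> {-\<epsilon>..\<epsilon>}" for t using \<epsilon> by (auto simp: clip_def)
  define J where "J f t = integral {-\<epsilon>..t} (\<lambda>s. F (apply_bcontfun f s))" for f :: "real \<Rightarrow>\<^sub>C 'b" and t
  have J_bound: "norm (J f t) \<le> M * (2 * \<epsilon>)" if "f \<in> S" "t \<in> {-\<epsilon>..\<epsilon>}" for f t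
  proof -
    have "norm (J f t) \<le> M * (t - - \<epsilon>)"
      unfolding J_def
      by (rule integral_bound[OF _ F_comp[OF that(1)]]) (use that M in \<open>auto simp: S_def\<close>)
    also have "\<dots> \<le> M * (2 * \<epsilon>)" using that M0 by (intro mult_left_mono) auto
    finally show ?thesis .
  qed
  have J_lip: "norm (J f t - J g t) \<le> K * (2 * \<epsilon>) * dist f g"
    if "f \<in> S" "g \<in> S" "t \<in> {-\<epsilon>..\<epsilon>}" for f g t
  proof -
    have "J f t - J g t = integral {-\<epsilon>..t} (\<lambda>s. F (apply_bcontfun f s) - F (apply_bcontfun g s))"
      unfolding J_def using that
      by (intro integral_diff[symmetric] integrable_continuous_real F_comp)
    also have "norm \<dots> \<le> K * dist f g * (t - - \<epsilon>)"
    proof (rule integral_bound)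
      show "continuous_on {-\<epsilon>..t} (\<lambda>s. F (apply_bcontfun f s) - F (apply_bcontfun g s))"
        using that by (intro continuous_on_diff F_comp)
      fix s
      have "norm (F (apply_bcontfun f s) - F (apply_bcontfun g s)) \<le> K * dist (apply_bcontfun f s) (apply_bcontfun g s)"
        using that lip[of "apply_bcontfun f s" "apply_bcontfun g s"] by (simp add: S_def dist_norm)
      also have "\<dots> \<le> K * dist f g" using K by (intro mult_left_mono dist_bounded)
      finally show "norm (F (apply_bcontfun f s) - F (apply_bcontfun g s)) \<le> K * dist f g" .
    qed (use that in auto)
    also have "\<dots> \<le> K * dist f g * (2 * \<epsilon>)" using that K by (intro mult_left_mono) auto
    finally show ?thesis by (simp add: mult_ac)
  qed
  have J_cont: "continuous_on {-\<epsilon>..\<epsilon>} (J f)" if "f \<in> S" for f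
    unfolding J_def by (intro indefinite_integral_continuous_1 integrable_continuous_real F_comp that)
  define \<Phi>0 where "\<Phi>0 f t = e + (J f (clip t) - J f 0)" for f t
  have zero: "0 \<in> {-\<epsilon>..\<epsilon>}" using \<epsilon> by simp
  have \<Phi>0_ball: "\<Phi>0 f t \<in> cball e r" if "f \<in> S" for f t
  proof -
    have "norm (J f (clip t) - J f 0) \<le> M * (2 * \<epsilon>) + M * (2 * \<epsilon>)"
      by (rule norm_triangle_le_diff[OF add_mono[OF J_bound[OF that clip] J_bound[OF that zero]]])
    then show ?thesis using \<epsilon>M by (simp add: \<Phi>0_def dist_norm norm_minus_commute[of "J f 0"])
  qed
  have \<Phi>0_bcontfun: "\<Phi>0 f \<in> bcontfun" if "f \<in> S" for f
  proof -
    have "continuous_on UNIV clip" unfolding clip_def by (intro continuous_intros)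
    then have "continuous_on UNIV (\<lambda>t. J f (clip t))"
      by (rule continuous_on_compose2[OF J_cont[OF that]]) (use clip in auto)
    then have "continuous_on UNIV (\<Phi>0 f)" unfolding \<Phi>0_def by (intro continuous_intros)
    moreover have "norm (\<Phi>0 f t) \<le> norm e + r" for t
      using \<Phi>0_ball[OF that, of t] norm_triangle_sub[of "\<Phi>0 f t" e]
      by (simp add: dist_norm norm_minus_commute)
    ultimately show ?thesis by (rule bcontfun_normI)
  qed
  define \<Phi> where "\<Phi> f = Bcontfun (\<Phi>0 f)" for f
  have \<Phi>: "apply_bcontfun (\<Phi> f) = \<Phi>0 f" if "f \<in> S" for f
    using \<Phi>0_bcontfun[OF that] by (simp add: \<Phi>_def Bcontfun_inverse)
  have "\<exists>!f\<in>S. \<Phi> f = f"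
  proof (rule Banach_fix)
    show "complete S" by fact
    have "const_bcontfun e \<in> S" using r by (simp add: S_def const_bcontfun.rep_eq)
    then show "S \<noteq> {}" by blast
    show "\<Phi> ` S \<subseteq> S" using \<Phi> \<Phi>0_ball by (auto simp: S_def)
    show "dist (\<Phi> f) (\<Phi> g) \<le> 1/2 * dist f g" if "f \<in> S" "g \<in> S" for f g
    proof (rule dist_bound)
      fix t
      have "dist (apply_bcontfun (\<Phi> f) t) (apply_bcontfun (\<Phi> g) t)
          = norm ((J f (clip t) - J g (clip t)) - (J f 0 - J g 0))"
        using that by (simp add: \<Phi> \<Phi>0_def dist_norm algebra_simps)
      also have "\<dots> \<le> K * (2 * \<epsilon>) * dist f g + K * (2 * \<epsilon>) * dist f g"
        by (rule norm_triangle_le_diff[OF add_mono[OF J_lip[OF that clip] J_lip[OF that zero]]])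
      also have "\<dots> = (K * (2 * \<epsilon>) + K * (2 * \<epsilon>)) * dist f g" by (simp add: algebra_simps)
      also have "\<dots> \<le> 1/2 * dist f g" using \<epsilon>K by (intro mult_right_mono) auto
      finally show "dist (apply_bcontfun (\<Phi> f) t) (apply_bcontfun (\<Phi> g) t) \<le> 1/2 * dist f g" .
    qed
  qed auto
  then obtain f where f: "f \<in> S" "\<Phi> f = f" by blast
  define \<gamma> where "\<gamma> = apply_bcontfun f"
  have \<gamma>: "\<gamma> t = e + (J f (clip t) - J f 0)" for t using \<Phi>[OF f(1)] f(2) by (simp add: \<gamma>_def \<Phi>0_def)
  have "(\<gamma> has_vector_derivative F (\<gamma> t)) (at t)" if t: "\<bar>t\<bar> < \<epsilon>" for t
  proof (rule has_vector_derivative_transform_within_open)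
    have "(J f has_vector_derivative F (\<gamma> t)) (at t within {-\<epsilon>..\<epsilon>})"
      unfolding J_def \<gamma>_def using t by (intro integral_has_vector_derivative F_comp f) auto
    then have J': "(J f has_vector_derivative F (\<gamma> t)) (at t)"
      using at_within_Icc_at[of "-\<epsilon>" t \<epsilon>] t by (simp add: abs_less_iff)
    show "((\<lambda>t. e + (J f t - J f 0)) has_vector_derivative F (\<gamma> t)) (at t)"
      using J' by (auto intro!: derivative_eq_intros)
    show "open {-\<epsilon><..<\<epsilon>}" "t \<in> {-\<epsilon><..<\<epsilon>}" using t by auto
    show "e + (J f s - J f 0) = \<gamma> s" if "s \<in> {-\<epsilon><..<\<epsilon>}" for s
      using that by (simp add: \<gamma> clip_def)
  qed
  moreover have "\<gamma> 0 = e" using \<epsilon> by (simp add: \<gamma> clip_def)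
  moreover have "\<gamma> t \<in> cball e r" for t using f(1) by (simp add: S_def \<gamma>_def)
  ultimately show ?thesis using \<epsilon> by blast
qed

text \<open>The model space is complete, being finite-dimensional, but its type is not of class banach.  Its
dual space is, and in finite dimension the map sending a vector to its inner product functional
is an isometry onto the dual; the equation is solved there and transported back.\<close>

lemma picard_local_frame:
  fixes F :: "'v::real_inner \<Rightarrow> 'v"
  assumes E: "coordinate_frame (E::'v set)" and r: "r > 0" and K: "K \<ge> 0"
    and lip: "\<And>x y. x \<in> cball e r \<Longrightarrow> y \<in> cball e r \<Longrightarrow> norm (F x - F y) \<le> K * norm (x - y)"
  shows "\<exists>\<epsilon>>0. \<exists>\<gamma>. \<gamma> 0 = e \<and>
    (\<forall>t. \<bar>t\<bar> < \<epsilon> \<longrightarrow> \<gamma> t \<in> cball e r \<and> (\<gamma> has_vector_derivative F (\<gamma> t)) (at t))"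
proof -
  define \<iota> :: "'v \<Rightarrow> ('v \<Rightarrow>\<^sub>L real)" where "\<iota> = blinfun_inner_right"
  define \<kappa> :: "('v \<Rightarrow>\<^sub>L real) \<Rightarrow> 'v" where "\<kappa> l = (\<Sum>b\<in>E. blinfun_apply l b *\<^sub>R b)" for l
  have \<iota>_apply: "blinfun_apply (\<iota> x) y = x \<bullet> y" for x y by (simp add: \<iota>_def)
  have \<iota>_diff: "\<iota> x - \<iota> y = \<iota> (x - y)" for x y
    by (rule blinfun_eqI) (simp add: \<iota>_apply blinfun.diff_left inner_diff_left)
  have \<iota>_norm: "norm (\<iota> x) = norm x" for x
  proof (rule antisym)
    show "norm (\<iota> x) \<le> norm x"
      by (rule norm_blinfun_bound) (simp_all add: \<iota>_apply Cauchy_Schwarz_ineq2)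
    have "norm x * norm x \<le> norm (\<iota> x) * norm x"
      using norm_blinfun[of "\<iota> x" x] by (simp add: \<iota>_apply dot_square_norm power2_eq_square)
    then show "norm x \<le> norm (\<iota> x)" by (cases "x = 0") auto
  qed
  have \<kappa>\<iota>: "\<kappa> (\<iota> x) = x" for x
    using coordinate_frame_expansion[OF E, of x] by (simp add: \<kappa>_def \<iota>_apply)
  have \<iota>\<kappa>: "\<iota> (\<kappa> l) = l" for l
  proof (rule blinfun_eqI)
    fix y
    have "linear (blinfun_apply l)" by (simp add: bounded_linear.linear blinfun.bounded_linear_right)
    then show "blinfun_apply (\<iota> (\<kappa> l)) y = blinfun_apply l y"
      using linear_frame_expansion[OF E, of "blinfun_apply l" y]
      by (simp add: \<iota>_apply \<kappa>_def inner_sum_left mult.commute inner_commute[of y])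
  qed
  have \<kappa>: "bounded_linear \<kappa>"
    unfolding \<kappa>_def
    by (intro bounded_linear_sum bounded_linear_scaleR_const blinfun.bounded_linear_left)
  have ball: "l \<in> cball (\<iota> e) r \<longleftrightarrow> \<kappa> l \<in> cball e r" for l
    using \<iota>_norm[of "e - \<kappa> l"] by (simp add: dist_norm \<iota>_diff[symmetric] \<iota>\<kappa>)
  have \<kappa>_norm: "norm (\<kappa> k - \<kappa> l) = norm (k - l)" for k l
    using \<iota>_norm[of "\<kappa> k - \<kappa> l"] by (simp add: \<iota>_diff[symmetric] \<iota>\<kappa>)
  have "norm (\<iota> (F (\<kappa> k)) - \<iota> (F (\<kappa> l))) \<le> K * norm (k - l)" if "k \<in> cball (\<iota> e) r" "l \<in> cball (\<iota> e) r" for k l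
    using lip[of "\<kappa> k" "\<kappa> l"] that unfolding ball by (simp add: \<iota>_diff \<iota>_norm \<kappa>_norm)
  from picard_local[OF r K, of "\<iota> e" "\<lambda>l. \<iota> (F (\<kappa> l))", OF this]
  obtain \<epsilon> \<gamma> where \<epsilon>: "\<epsilon> > 0" and \<gamma>: "\<gamma> 0 = \<iota> e"
    "\<And>t. \<bar>t\<bar> < \<epsilon> \<Longrightarrow> \<gamma> t \<in> cball (\<iota> e) r \<and> (\<gamma> has_vector_derivative \<iota> (F (\<kappa> (\<gamma> t)))) (at t)"
    by blast
  have "((\<lambda>t. \<kappa> (\<gamma> t)) has_vector_derivative F (\<kappa> (\<gamma> t))) (at t)" if "\<bar>t\<bar> < \<epsilon>" for t
    using bounded_linear.has_vector_derivative[OF \<kappa> conjunct2[OF \<gamma>(2)[OF that]]] by (simp add: \<kappa>\<iota>)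
  moreover have "\<kappa> (\<gamma> t) \<in> cball e r" if "\<bar>t\<bar> < \<epsilon>" for t using \<gamma>(2)[OF that] ball by blast
  ultimately show ?thesis
    using \<epsilon> \<gamma>(1) by (intro exI[of _ \<epsilon>] conjI exI[of _ "\<lambda>t. \<kappa> (\<gamma> t)"]) (auto simp: \<kappa>\<iota>)
qed

context lie_group_chart
begin

lemma chart_inverse_continuous: "continuous_map (top_of_set (\<phi> ` U)) (topol G) (inv_into U \<phi>)"
proof -
  obtain \<psi> where \<psi>: "homeomorphic_maps (subtopology (topol G) U) (top_of_set (\<phi> ` U)) \<phi> \<psi>"
    using chart_homeomorphic[OF chart] homeomorphic_map_maps by blast
  then have "continuous_map (top_of_set (\<phi> ` U)) (topol G) \<psi>"
    by (auto simp: homeomorphic_maps_def continuous_map_in_subtopology)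
  moreover have "\<psi> z = inv_into U \<phi> z" if "z \<in> topspace (top_of_set (\<phi> ` U))" for z
    using that \<psi> chart_openin[OF chart]
    by (auto simp: homeomorphic_maps_def Int_absorb1 openin_subset)
  ultimately show ?thesis by (rule continuous_map_eq)
qed

text \<open>In the chart the left-invariant vector field with value \<open>v\<close> at the identity is the derivative of
the multiplication in its second argument, at the point and in direction \<open>v\<close>.  Smoothness of the
multiplication makes it locally Lipschitz, and a solution has body velocity \<open>v\<close>.\<close>

lemma integral_curve_exists:
  "\<exists>\<epsilon>>0. \<exists>c. c 0 = \<one> \<and> continuous_map (top_of_set {-\<epsilon><..<\<epsilon>}) (topol G) c \<and>
    (\<forall>t. \<bar>t\<bar> < \<epsilon> \<longrightarrow> c t \<in> carrier G \<and> body_velocity c t v)"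
proof -
  obtain E :: "'v set" where E: "coordinate_frame E" by (rule model_frame)
  then obtain P :: "('v \<times> 'v) set" where P: "coordinate_frame P" using coordinate_frame_prod by blast
  let ?mult = "\<lambda>(x, y). x \<otimes> y"
  define \<mu> where "\<mu> z = \<phi> (?mult (inv_into (U \<times> U) (map_prod \<phi> \<phi>) z))" for z
  let ?\<Omega> = "map_prod \<phi> \<phi> ` {p \<in> (U \<times> U) \<inter> carrier G \<times> carrier G. ?mult p \<in> U}"
  have \<mu>: "smooth_on ?\<Omega> \<mu>"
    using smooth_map_onD[OF smooth_mult chart_prod chart] by (simp add: \<mu>_def[abs_def])
  define F where "F x = frechet_derivative \<mu> (at (x, \<phi> \<one>)) (0, v)" for x
  have "smooth_on UNIV (\<lambda>x::'v. (x, \<phi> \<one>))"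
    using smooth_on_Pair[OF smooth_on_bounded_linear[OF open_UNIV bounded_linear_ident]
        smooth_on_const[OF open_UNIV]] by simp
  from smooth_on_compose[OF P this smooth_on_directional[OF \<mu>, of "(0, v)"]]
  have F': "smooth_on (UNIV \<inter> (\<lambda>x. (x, \<phi> \<one>)) -` ?\<Omega>) F" by (simp add: F_def[abs_def])
  have \<Omega>: "UNIV \<inter> (\<lambda>x. (x, \<phi> \<one>)) -` ?\<Omega> = \<phi> ` U"
  proof (intro equalityI subsetI)
    fix x assume "x \<in> \<phi> ` U"
    then obtain p where p: "p \<in> U" "x = \<phi> p" by blast
    then have "(p, \<one>) \<in> {p \<in> (U \<times> U) \<inter> carrier G \<times> carrier G. ?mult p \<in> U}"
      using one_in_chart U_carrier by auto
    then have "map_prod \<phi> \<phi> (p, \<one>) \<in> ?\<Omega>" by (rule imageI)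
    then show "x \<in> UNIV \<inter> (\<lambda>x. (x, \<phi> \<one>)) -` ?\<Omega>" using p by simp
  qed auto
  have F: "smooth_on (\<phi> ` U) F" using F' unfolding \<Omega> .
  obtain r K where r: "r > 0" "K \<ge> 0" "cball (\<phi> \<one>) r \<subseteq> \<phi> ` U"
    and lip: "\<And>x y. x \<in> cball (\<phi> \<one>) r \<Longrightarrow> y \<in> cball (\<phi> \<one>) r \<Longrightarrow> norm (F x - F y) \<le> K * norm (x - y)"
    using smooth_on_locally_lipschitz[OF E F imageI[OF one_in_chart]] by blast
  obtain \<epsilon> \<gamma> where \<epsilon>: "\<epsilon> > 0" and \<gamma>: "\<gamma> 0 = \<phi> \<one>"
    "\<And>t. \<bar>t\<bar> < \<epsilon> \<Longrightarrow> \<gamma> t \<in> cball (\<phi> \<one>) r" "\<And>t. \<bar>t\<bar> < \<epsilon> \<Longrightarrow> (\<gamma> has_vector_derivative F (\<gamma> t)) (at t)"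
    using picard_local_frame[OF E r(1,2) lip] by blast
  define c where "c t = inv_into U \<phi> (\<gamma> t)" for t
  have c: "c t \<in> U" "\<phi> (c t) = \<gamma> t" if "\<bar>t\<bar> < \<epsilon>" for t
    using \<gamma>(2)[OF that] r(3) by (auto simp: c_def inv_into_into f_inv_into_f)
  have "body_velocity c t v" if t: "\<bar>t\<bar> < \<epsilon>" for t
  proof -
    have ct: "c t \<in> U" "c t \<in> carrier G" using c t U_carrier by auto
    have "((\<lambda>h. t + h) \<longlongrightarrow> t + 0) (nhds 0)" by (intro tendsto_intros filterlim_ident)
    then have "\<forall>\<^sub>F h in nhds 0. t + h \<in> {-\<epsilon><..<\<epsilon>}"
      using t by (intro topological_tendstoD) auto
    then have near: "\<forall>\<^sub>F h in nhds 0. \<bar>t + h\<bar> < \<epsilon>" by (rule eventually_mono) auto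
    have "((\<lambda>h. t + h) has_derivative (\<lambda>h. h)) (at 0)" by (auto intro!: derivative_eq_intros)
    moreover have "(\<gamma> has_derivative (\<lambda>h. h *\<^sub>R F (\<gamma> t))) (at (t + 0))"
      using \<gamma>(3)[OF t] by (simp add: has_vector_derivative_def)
    ultimately have "((\<lambda>h. \<gamma> (t + h)) has_derivative (\<lambda>h. h *\<^sub>R F (\<gamma> t))) (at 0)"
      using has_derivative_compose[of "\<lambda>h. t + h" "\<lambda>h. h" 0 UNIV \<gamma>] by simp
    then have "moves UNIV id (\<lambda>h. \<gamma> (t + h)) (F (\<gamma> t))" by (simp add: moves_def has_vector_derivative_def)
    then have "moves UNIV id (\<lambda>h. \<phi> (c (t + h))) (F (\<gamma> t))"
      by (rule moves_cong) (rule eventually_mono[OF near], simp add: c)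
    moreover have "\<forall>\<^sub>F h in nhds 0. c (t + h) \<in> U" by (rule eventually_mono[OF near]) (simp add: c)
    ultimately have c_moves: "moves U \<phi> (\<lambda>h. c (t + h)) (F (\<gamma> t))" by (simp add: moves_def)
    let ?M = "frechet_derivative (\<lambda>z. \<phi> (inv (c t) \<otimes> inv_into U \<phi> z)) (at (\<phi> (c t)))"
    have M: "moves U \<phi> (\<lambda>h. inv (c t) \<otimes> x h) (?M w)" if "moves U \<phi> x w" "x 0 = c t" for x w
      using moves_image[OF charted chart smooth_left_mult[of "inv (c t)"] that(1) _ chart] that(2) ct one_in_chart
      by simp
    have "moves U \<phi> (\<lambda>h. ?mult (c t, line v h)) (frechet_derivative \<mu> (at (map_prod \<phi> \<phi> (c t, line v 0))) (0, v))"
      unfolding \<mu>_def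
      by (rule moves_image[OF charted2 chart_prod smooth_mult moves_Pair[OF moves_const line_moves] _ chart])
        (use ct in auto)
    then have "moves U \<phi> (\<lambda>h. c t \<otimes> line v h) (F (\<gamma> t))" using t by (simp add: F_def c)
    \<comment> \<open>Moving away by c t and back again is the identity, so the derivative M of the way back
      undoes the vector field.\<close>
    from M[OF this] have "moves U \<phi> (\<lambda>h. inv (c t) \<otimes> (c t \<otimes> line v h)) (?M (F (\<gamma> t)))" using ct by simp
    moreover have "\<forall>\<^sub>F h in nhds 0. inv (c t) \<otimes> (c t \<otimes> line v h) = line v h"
    proof -
      have "\<forall>\<^sub>F h in nhds 0. line v h \<in> U" using line_moves by (simp add: moves_def)
      then show ?thesis
        by (rule eventually_mono) (use ct U_carrier in \<open>simp add: inv_mult_cancel\<close>)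
    qed
    ultimately have "moves U \<phi> (line v) (?M (F (\<gamma> t)))" by (rule moves_cong)
    then have "?M (F (\<gamma> t)) = v" using moves_unique line_moves by blast
    then show ?thesis using M[OF c_moves] by (simp add: body_velocity_def)
  qed
  moreover have "c 0 = \<one>" using \<gamma>(1) one_in_chart by (simp add: c_def)
  moreover have "continuous_map (top_of_set {-\<epsilon><..<\<epsilon>}) (topol G) c"
  proof -
    have "continuous_on {-\<epsilon><..<\<epsilon>} \<gamma>"
      by (intro continuous_at_imp_continuous_on ballI has_vector_derivative_continuous[OF \<gamma>(3)]) auto
    moreover have "\<gamma> ` {-\<epsilon><..<\<epsilon>} \<subseteq> \<phi> ` U" using \<gamma>(2) r(3) by force
    ultimately have "continuous_map (top_of_set {-\<epsilon><..<\<epsilon>}) (top_of_set (\<phi> ` U)) \<gamma>" by auto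
    from continuous_map_compose[OF this chart_inverse_continuous]
    show ?thesis by (simp add: c_def[abs_def] o_def)
  qed
  moreover have "c t \<in> carrier G" if "\<bar>t\<bar> < \<epsilon>" for t using c(1)[OF that] U_carrier by blast
  ultimately show ?thesis using \<epsilon> by blast
qed

end

section \<open>The Lie algebra in a chart\<close>

context lie_group_chart
begin

text \<open>The tangent vector at the identity with coordinates \<open>v\<close>: differentiation in direction \<open>v\<close>, with the
value \<open>0\<close> off smooth germs as for velocities of curves.\<close>

definition tangent :: "'v \<Rightarrow> 'a tangent" where
  "tangent v = (\<lambda>f. if smooth_germ G \<one> f
     then frechet_derivative (\<lambda>z. f (inv_into U \<phi> z)) (at (\<phi> \<one>)) v else 0)"

text \<open>Only differentiability of the curve at time \<open>0\<close> matters here, so the lemma also applies to curves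
that are not known to be smooth.\<close>

lemma velocity_eq_tangent:
  assumes c: "moves U \<phi> c v" "c 0 = \<one>"
  shows "velocity G c = tangent v"
proof
  fix f
  show "velocity G c f = tangent v f"
  proof (cases "smooth_germ G \<one> f")
    case True
    then obtain W where W: "\<one> \<in> W" "smooth_map_on (topol G) (atlas G) euclidean real_atlas W f"
      by (auto simp: smooth_germ_def)
    have "moves UNIV id (\<lambda>h. f (c h))
        (frechet_derivative (\<lambda>z. id (f (inv_into U \<phi> z))) (at (\<phi> (c 0))) v)"
      by (rule moves_image[OF charted chart W(2) c(1)]) (use W(1) c(2) in \<open>auto simp: real_atlas_def\<close>)
    then have "((\<lambda>h. f (c h)) has_real_derivative tangent v f) (at 0)"
      using True c(2) by (simp add: moves_def tangent_def has_real_derivative_iff_has_vector_derivative)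
    then have "deriv (\<lambda>h. f (c h)) 0 = tangent v f" by (rule DERIV_imp_deriv)
    then show ?thesis using True c(2) by (simp add: velocity_def o_def)
  next
    case False
    then show ?thesis using c(2) by (simp add: velocity_def tangent_def)
  qed
qed

lemma tangent_linear: "linear (\<lambda>v. tangent v f)"
proof (cases "smooth_germ G \<one> f")
  case True
  then obtain W where W: "\<one> \<in> W" "smooth_map_on (topol G) (atlas G) euclidean real_atlas W f"
    by (auto simp: smooth_germ_def)
  have R: "(UNIV, id) \<in> real_atlas" by (simp add: real_atlas_def)
  have "smooth_on (\<phi> ` {x \<in> U \<inter> W. f x \<in> UNIV}) (\<lambda>z. id (f (inv_into U \<phi> z)))"
    by (rule smooth_map_onD[OF W(2) chart R])
  from smooth_on_differentiable[OF this, of "\<phi> \<one>"] W(1) one_in_chart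
  show ?thesis using True by (auto simp: tangent_def intro: has_derivative_linear)
next
  case False
  then show ?thesis by (simp add: tangent_def linear_zero)
qed

lemma tangent_add: "tangent (v + w) = (\<lambda>f. tangent v f + tangent w f)"
  using linear_add[OF tangent_linear] by blast

lemma tangent_scale: "tangent (a *\<^sub>R v) = (\<lambda>f. a * tangent v f)"
  using linear_scale[OF tangent_linear] by auto

lemma smooth_coordinate_germ: "smooth_germ G \<one> (\<lambda>x. \<phi> x \<bullet> b)"
  unfolding smooth_germ_def
proof (intro exI conjI)
  show "\<one> \<in> U" by (rule one_in_chart)
  show "smooth_map_on (topol G) (atlas G) euclidean real_atlas U (\<lambda>x. \<phi> x \<bullet> b)"
  proof (rule smooth_map_onI)
    show "openin (topol G) U" by (rule chart_openin[OF chart])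
    have "continuous_map (subtopology (topol G) U) euclidean \<phi>"
      using homeomorphic_imp_continuous_map[OF chart_homeomorphic[OF chart]]
      by (simp add: continuous_map_in_subtopology)
    moreover have "continuous_map euclidean euclidean (\<lambda>z. z \<bullet> b)"
      by (simp add: continuous_on_inner continuous_on_const)
    ultimately show "continuous_map (subtopology (topol G) U) euclidean (\<lambda>x. \<phi> x \<bullet> b)"
      using continuous_map_compose[of _ _ \<phi> _ "\<lambda>z. z \<bullet> b"] by (simp add: o_def)
  next
    fix V \<psi> R \<rho> assume V: "(V, \<psi>) \<in> atlas G" and "(R :: real set, \<rho>) \<in> real_atlas"
    then have R: "R = UNIV" "\<rho> = id" by (auto simp: real_atlas_def)
    have "smooth_on (\<psi> ` (V \<inter> U)) (\<lambda>z. \<phi> (inv_into V \<psi> z) \<bullet> b)"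
      using chart_transition[OF V chart] Ck_on_bounded_linear_comp[OF bounded_linear_inner_left[of b]]
      by (auto simp: smooth_on_def)
    then show "smooth_on (\<psi> ` {x \<in> V \<inter> U. \<phi> x \<bullet> b \<in> R}) (\<lambda>z. \<rho> (\<phi> (inv_into V \<psi> z) \<bullet> b))"
      by (simp add: R Int_def)
  qed
qed

lemma tangent_coordinate: "tangent v (\<lambda>x. \<phi> x \<bullet> b) = v \<bullet> b"
proof -
  have "((\<lambda>h. \<phi> (line v h)) has_derivative (\<lambda>h. h *\<^sub>R v)) (at 0)"
    using line_moves by (simp add: moves_def has_vector_derivative_def)
  then have "((\<lambda>h. \<phi> (line v h) \<bullet> b) has_derivative (\<lambda>h. (h *\<^sub>R v) \<bullet> b)) (at 0)"
    by (rule has_derivative_inner_left)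
  then have "((\<lambda>h. \<phi> (line v h) \<bullet> b) has_real_derivative v \<bullet> b) (at 0)"
    by (simp add: has_real_derivative_iff_has_vector_derivative has_vector_derivative_def)
  then have "deriv ((\<lambda>x. \<phi> x \<bullet> b) \<circ> line v) 0 = v \<bullet> b" by (simp add: DERIV_imp_deriv o_def)
  moreover have "tangent v (\<lambda>x. \<phi> x \<bullet> b) = velocity G (line v) (\<lambda>x. \<phi> x \<bullet> b)"
    by (simp add: velocity_eq_tangent[OF line_moves])
  ultimately show ?thesis by (simp add: velocity_def smooth_coordinate_germ)
qed

text \<open>Coordinate functions are smooth germs, and they recover the coordinates of a tangent vector.\<close>

lemma tangent_inject: "tangent v = tangent w \<Longrightarrow> v = w"
proof -
  assume "tangent v = tangent w"
  then have "v \<bullet> (v - w) = w \<bullet> (v - w)" using tangent_coordinate by metis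
  then have "(v - w) \<bullet> (v - w) = 0" by (simp add: inner_diff_left)
  then show ?thesis by simp
qed

lemma line_smooth:
  "smooth_map_on euclidean real_atlas (topol G) (atlas G) {t. \<phi> \<one> + t *\<^sub>R v \<in> \<phi> ` U} (line v)"
proof (rule smooth_map_onI)
  let ?l = "\<lambda>t. \<phi> \<one> + t *\<^sub>R v"
  have l_cont: "continuous_on A ?l" for A by (intro continuous_intros)
  have "open (?l -` \<phi> ` U)"
    using continuous_open_preimage[OF l_cont open_UNIV chart_range_open[OF chart]] by simp
  then show "openin euclidean {t. ?l t \<in> \<phi> ` U}" by (simp add: vimage_def)
  have "continuous_map (top_of_set {t. ?l t \<in> \<phi> ` U}) (top_of_set (\<phi> ` U)) ?l"
    using l_cont by (auto simp: continuous_map_in_subtopology)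
  from continuous_map_compose[OF this chart_inverse_continuous]
  show "continuous_map (top_of_set {t. ?l t \<in> \<phi> ` U}) (topol G) (line v)"
    by (simp add: line_def[abs_def] o_def)
next
  let ?l = "\<lambda>t. \<phi> \<one> + t *\<^sub>R v"
  fix R \<rho> V \<psi> assume "(R :: real set, \<rho>) \<in> real_atlas" and V: "(V, \<psi>) \<in> atlas G"
  then have R: "R = UNIV" "\<rho> = id" by (auto simp: real_atlas_def)
  obtain E :: "'v set" where E: "coordinate_frame E" by (rule model_frame)
  have "Ck_on k UNIV ?l" for k
    by (intro Ck_on_add Ck_on_const Ck_on_bounded_linear bounded_linear_scaleR_left)
  then have "smooth_on UNIV ?l" by (simp add: smooth_on_def)
  from smooth_on_compose[OF E this chart_transition[OF chart V]]
  have "smooth_on (?l -` \<phi> ` (U \<inter> V)) (\<lambda>t. \<psi> (line v t))" by (simp add: line_def)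
  moreover have "?l -` \<phi> ` (U \<inter> V) = \<rho> ` {t \<in> R \<inter> {t. ?l t \<in> \<phi> ` U}. line v t \<in> V}"
    by (force simp: R line_def)
  ultimately show "smooth_on (\<rho> ` {t \<in> R \<inter> {t. ?l t \<in> \<phi> ` U}. line v t \<in> V})
      (\<lambda>z. \<psi> (line v (inv_into R \<rho> z)))"
    by (simp add: R inv_into_def)
qed

text \<open>Coordinates thus identify the Lie algebra with the model space; in particular it is a
finite-dimensional vector space.\<close>

lemma lie_algebra_eq: "lie_algebra G (carrier G) = range tangent"
proof
  have re: "charted euclidean real_atlas" "(UNIV, id) \<in> real_atlas"
    by (auto simp: charted_def real_atlas_def)
  show "lie_algebra G (carrier G) \<subseteq> range tangent"
  proof
    fix X assume "X \<in> lie_algebra G (carrier G)"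
    then obtain c W where c: "X = velocity G c" "c 0 = \<one>" "0 \<in> W"
      "smooth_map_on euclidean real_atlas (topol G) (atlas G) W c"
      by (auto simp: lie_algebra_def)
    have "((\<lambda>h. h) has_vector_derivative (1::real)) (at 0)" by (auto intro!: derivative_eq_intros)
    then have "moves UNIV id (\<lambda>h::real. h) 1" by (simp add: moves_def)
    from moves_image[OF re c(4) this c(3) chart] c(2) one_in_chart
    obtain v where "moves U \<phi> c v" by auto
    then show "X \<in> range tangent" using velocity_eq_tangent c by auto
  qed
  show "range tangent \<subseteq> lie_algebra G (carrier G)"
  proof
    fix X assume "X \<in> range tangent"
    then obtain v where X: "X = velocity G (line v)" using velocity_eq_tangent[OF line_moves] by auto
    have sub: "line v ` {t. \<phi> \<one> + t *\<^sub>R v \<in> \<phi> ` U} \<subseteq> carrier G"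
      using U_carrier by (auto simp: line_def)
    have zero: "0 \<in> {t. \<phi> \<one> + t *\<^sub>R v \<in> \<phi> ` U}" using one_in_chart by simp
    show "X \<in> lie_algebra G (carrier G)"
      unfolding lie_algebra_def mem_Collect_eq[of X]
      by (intro exI[of _ "line v"] exI[of _ "{t. \<phi> \<one> + t *\<^sub>R v \<in> \<phi> ` U}"]
          conjI line_smooth line_0 X sub zero)
  qed
qed

section \<open>The adjoint action\<close>

lemma smooth_germ_cong:
  assumes "\<And>x. x \<in> carrier G \<Longrightarrow> f x = k x" "smooth_germ G p f"
  shows "smooth_germ G p k"
proof -
  obtain W where W: "p \<in> W" and f: "smooth_map_on (topol G) (atlas G) euclidean real_atlas W f"
    using assms(2) by (auto simp: smooth_germ_def)
  have WG: "W \<subseteq> carrier G" using openin_subset[OF smooth_map_on_openin[OF f]] topspace_eq by simp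
  have "smooth_map_on (topol G) (atlas G) euclidean real_atlas W k"
  proof (rule smooth_map_onI)
    show "openin (topol G) W" by (rule smooth_map_on_openin[OF f])
    show "continuous_map (subtopology (topol G) W) euclidean k"
      by (rule continuous_map_eq[of _ _ f]) (use f assms(1) topspace_eq in \<open>auto simp: smooth_map_on_def\<close>)
    fix V \<psi> R \<rho> assume V: "(V, \<psi>) \<in> atlas G" and R: "(R :: real set, \<rho>) \<in> real_atlas"
    have eq: "{x \<in> V \<inter> W. f x \<in> R} = {x \<in> V \<inter> W. k x \<in> R}" using assms(1) WG by auto
    show "smooth_on (\<psi> ` {x \<in> V \<inter> W. k x \<in> R}) (\<lambda>z. \<rho> (k (inv_into V \<psi> z)))"
      using smooth_map_onD[OF f V R] unfolding eq
      by (rule smooth_on_cong) (use assms(1) WG inv_into_chart[OF charted V] in auto)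
  qed
  then show ?thesis using W by (auto simp: smooth_germ_def)
qed

lemma smooth_germ_conj:
  assumes g: "g \<in> carrier G" and f: "smooth_germ G \<one> f"
  shows "smooth_germ G \<one> (\<lambda>x. f (g \<otimes> x \<otimes> inv g))"
proof -
  obtain E :: "'v set" where E: "coordinate_frame E" by (rule model_frame)
  obtain W where W: "\<one> \<in> W" "smooth_map_on (topol G) (atlas G) euclidean real_atlas W f"
    using f by (auto simp: smooth_germ_def)
  have "\<one> \<in> {x \<in> carrier G. g \<otimes> x \<otimes> inv g \<in> W}" using g W(1) by simp
  moreover have "smooth_map_on (topol G) (atlas G) euclidean real_atlas
      {x \<in> carrier G. g \<otimes> x \<otimes> inv g \<in> W} (\<lambda>x. f (g \<otimes> x \<otimes> inv g))"
    by (rule smooth_map_on_compose[OF E charted charted smooth_conj[OF g] W(2)])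
  ultimately show ?thesis unfolding smooth_germ_def by (intro exI conjI)
qed

lemma conj_inv_cancel:
  "g \<in> carrier G \<Longrightarrow> x \<in> carrier G \<Longrightarrow> g \<otimes> (inv g \<otimes> x \<otimes> inv (inv g)) \<otimes> inv g = x"
  by (simp add: m_assoc mult_inv_cancel)

text \<open>The convention for functions that are not smooth germs has to be respected by conjugation;
this is why both directions are needed.\<close>

lemma smooth_germ_conj_iff:
  assumes g: "g \<in> carrier G"
  shows "smooth_germ G \<one> (\<lambda>x. f (g \<otimes> x \<otimes> inv g)) \<longleftrightarrow> smooth_germ G \<one> f"
proof
  assume "smooth_germ G \<one> (\<lambda>x. f (g \<otimes> x \<otimes> inv g))"
  from smooth_germ_conj[OF inv_closed[OF g] this] show "smooth_germ G \<one> f"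
    by (rule smooth_germ_cong[rotated]) (simp only: conj_inv_cancel[OF g])
qed (rule smooth_germ_conj[OF g])

lemma Ad_velocity:
  assumes "g \<in> carrier G" "c 0 = \<one>"
  shows "Ad G g (velocity G c) = velocity G (\<lambda>t. g \<otimes> c t \<otimes> inv g)"
  using assms by (auto simp: Ad_def velocity_def smooth_germ_conj_iff o_def)

definition Ad_chart :: "'a \<Rightarrow> 'v \<Rightarrow> 'v" where
  "Ad_chart g = frechet_derivative (\<lambda>z. \<phi> (g \<otimes> inv_into U \<phi> z \<otimes> inv g)) (at (\<phi> \<one>))"

lemma conj_moves:
  assumes "g \<in> carrier G" "moves U \<phi> c v" "c 0 = \<one>"
  shows "moves U \<phi> (\<lambda>h. g \<otimes> c h \<otimes> inv g) (Ad_chart g v)"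
  using moves_image[OF charted chart smooth_conj[OF assms(1)] assms(2) _ chart] assms one_in_chart
  by (simp add: Ad_chart_def)

lemma Ad_tangent:
  assumes g: "g \<in> carrier G" shows "Ad G g (tangent v) = tangent (Ad_chart g v)"
proof -
  have "Ad G g (tangent v) = Ad G g (velocity G (line v))"
    by (simp add: velocity_eq_tangent[OF line_moves])
  also have "\<dots> = velocity G (\<lambda>t. g \<otimes> line v t \<otimes> inv g)" by (rule Ad_velocity[OF g]) simp
  also have "\<dots> = tangent (Ad_chart g v)"
    using g by (intro velocity_eq_tangent conj_moves line_moves) simp_all
  finally show ?thesis .
qed

text \<open>Both sides are the velocity of a straight line that has been conjugated back and forth.\<close>

lemma Ad_chart_inverse:
  assumes g: "g \<in> carrier G" shows "Ad_chart g (Ad_chart (inv g) v) = v"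
proof -
  have "moves U \<phi> (\<lambda>h. g \<otimes> (inv g \<otimes> line v h \<otimes> inv (inv g)) \<otimes> inv g) (Ad_chart g (Ad_chart (inv g) v))"
    using g by (intro conj_moves inv_closed line_moves) simp_all
  moreover have "\<forall>\<^sub>F h in nhds 0. line v h \<in> U" using line_moves by (simp add: moves_def)
  then have "\<forall>\<^sub>F h in nhds 0. g \<otimes> (inv g \<otimes> line v h \<otimes> inv (inv g)) \<otimes> inv g = line v h"
    by (rule eventually_mono) (simp only: conj_inv_cancel[OF g U_carrier])
  ultimately have "moves U \<phi> (line v) (Ad_chart g (Ad_chart (inv g) v))" by (rule moves_cong)
  then show ?thesis using moves_unique line_moves by blast
qed

end

section \<open>Tori as closures of commuting sets\<close>

context lie_group
begin

lemma centralizerD: "g \<in> centralizer G S \<Longrightarrow> s \<in> S \<Longrightarrow> g \<otimes> s = s \<otimes> g"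
  by (simp add: centralizer_def)

lemma centralizer_subgroup:
  assumes "S \<subseteq> carrier G" shows "subgroup (centralizer G S) G"
proof (rule subgroupI)
  show "centralizer G S \<noteq> {}" using assms by (auto simp: centralizer_def intro!: exI[of _ \<one>])
  fix g assume g: "g \<in> centralizer G S"
  then have gc: "g \<in> carrier G" by (simp add: centralizer_def)
  have "inv g \<otimes> s = s \<otimes> inv g" if "s \<in> S" for s
  proof -
    have s: "s \<in> carrier G" using that assms by blast
    have "inv g \<otimes> s = inv g \<otimes> (s \<otimes> g) \<otimes> inv g" using gc s by (simp add: m_assoc)
    also have "\<dots> = inv g \<otimes> (g \<otimes> s) \<otimes> inv g" using centralizerD[OF g that] by simp
    also have "\<dots> = s \<otimes> inv g" using gc s by (simp add: m_assoc[symmetric])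
    finally show ?thesis .
  qed
  then show "inv g \<in> centralizer G S" using gc by (simp add: centralizer_def)
  fix h assume h: "h \<in> centralizer G S"
  then have hc: "h \<in> carrier G" by (simp add: centralizer_def)
  have "g \<otimes> h \<otimes> s = s \<otimes> (g \<otimes> h)" if "s \<in> S" for s
  proof -
    have s: "s \<in> carrier G" using that assms by blast
    have "g \<otimes> h \<otimes> s = g \<otimes> (s \<otimes> h)" using centralizerD[OF h that] gc hc s by (simp add: m_assoc)
    also have "\<dots> = s \<otimes> g \<otimes> h" using centralizerD[OF g that] gc hc s by (simp add: m_assoc[symmetric])
    finally show ?thesis using gc hc s by (simp add: m_assoc)
  qed
  then show "g \<otimes> h \<in> centralizer G S" using gc hc by (simp add: centralizer_def)
qed (auto simp: centralizer_def)

lemma commute_generate: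
  assumes "S \<subseteq> carrier G" "g \<in> centralizer G S"
  shows "g \<in> centralizer G (generate G S)"
proof -
  have g: "g \<in> carrier G" using assms(2) by (simp add: centralizer_def)
  have "S \<subseteq> centralizer G {g}" using assms by (auto simp: centralizer_def)
  then have "generate G S \<subseteq> centralizer G {g}"
    using g by (intro generate_subgroup_incl centralizer_subgroup) auto
  then show ?thesis using g by (auto simp: centralizer_def)
qed

lemma subtopology_carrier [simp]: "subtopology (topol G) (carrier G) = topol G"
  by (metis topspace_eq subtopology_topspace)

lemma continuous_left_mult: "a \<in> carrier G \<Longrightarrow> continuous_map (topol G) (topol G) (\<lambda>x. a \<otimes> x)"
  using smooth_left_mult[of a] by (simp add: smooth_map_on_def)

lemma continuous_right_mult: "a \<in> carrier G \<Longrightarrow> continuous_map (topol G) (topol G) (\<lambda>x. x \<otimes> a)"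
  using smooth_mult_comp[OF charted smooth_id smooth_const, of a] by (simp add: smooth_map_on_def)

lemma continuous_inverse: "continuous_map (topol G) (topol G) (\<lambda>x. inv x)"
  using smooth_inv by (simp add: smooth_map_on_def)

text \<open>Commuting with a fixed element is a closed condition in a Hausdorff group.\<close>

lemma commute_closure:
  assumes "S \<subseteq> carrier G" "g \<in> centralizer G S"
  shows "g \<in> centralizer G (topol G closure_of S)"
proof -
  have g: "g \<in> carrier G" using assms(2) by (simp add: centralizer_def)
  have "closedin (topol G) {x \<in> topspace (topol G). g \<otimes> x = x \<otimes> g}"
    by (rule closedin_continuous_maps_eq[OF Hausdorff continuous_left_mult[OF g] continuous_right_mult[OF g]])
  moreover have "S \<subseteq> {x \<in> topspace (topol G). g \<otimes> x = x \<otimes> g}"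
    using assms topspace_eq by (auto simp: centralizer_def)
  ultimately have "topol G closure_of S \<subseteq> {x \<in> topspace (topol G). g \<otimes> x = x \<otimes> g}"
    by (intro closure_of_minimal)
  then show ?thesis using g by (auto simp: centralizer_def)
qed

text \<open>Separate continuity of the multiplication suffices: first multiply by elements of \<open>S\<close> from the
left, then by elements of the closure from the right.\<close>

lemma closure_subgroup:
  assumes S: "subgroup S G" shows "subgroup (topol G closure_of S) G"
proof -
  let ?C = "topol G closure_of S"
  have sub: "S \<subseteq> ?C" using subgroup.subset[OF S] topspace_eq by (intro closure_of_subset) simp
  have C: "x \<in> carrier G" if "x \<in> ?C" for x
    using that closure_of_subset_topspace[of "topol G" S] topspace_eq by auto
  have step: "f ` ?C \<subseteq> ?C" if "continuous_map (topol G) (topol G) f" "f ` S \<subseteq> ?C" for f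
  proof -
    have "f ` ?C \<subseteq> topol G closure_of (f ` S)" by (rule continuous_map_image_closure_subset[OF that(1)])
    also have "\<dots> \<subseteq> ?C" by (rule closure_of_minimal[OF that(2)]) simp
    finally show ?thesis .
  qed
  have "s \<otimes> y \<in> ?C" if "s \<in> S" "y \<in> ?C" for s y
  proof -
    have "(\<lambda>x. s \<otimes> x) ` ?C \<subseteq> ?C"
    proof (rule step)
      show "continuous_map (topol G) (topol G) (\<lambda>x. s \<otimes> x)"
        using that(1) subgroup.mem_carrier[OF S] by (intro continuous_left_mult)
      show "(\<lambda>x. s \<otimes> x) ` S \<subseteq> ?C" using that(1) subgroup.m_closed[OF S] sub by auto
    qed
    then show ?thesis using that(2) by auto
  qed
  then have "(\<lambda>x. x \<otimes> y) ` ?C \<subseteq> ?C" if "y \<in> ?C" for y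
    using that C by (intro step continuous_right_mult) auto
  moreover have "(\<lambda>x. inv x) ` ?C \<subseteq> ?C"
    using subgroup.m_inv_closed[OF S] sub by (intro step continuous_inverse) auto
  ultimately show ?thesis
    using C sub subgroup.one_closed[OF S] by (intro subgroupI) auto
qed

text \<open>Each element of the generated group lies in a connected subset of it that contains the identity:
for a product, translate the set of the second factor so that it starts at the first factor.\<close>

lemma generate_connected:
  assumes \<Gamma>: "\<Gamma> \<subseteq> carrier G" "\<one> \<in> \<Gamma>" "connectedin (topol G) \<Gamma>"
  shows "connectedin (topol G) (generate G \<Gamma>)"
proof -
  define \<K> where "\<K> = {K. connectedin (topol G) K \<and> \<one> \<in> K \<and> K \<subseteq> generate G \<Gamma>}"
  have "\<exists>K\<in>\<K>. x \<in> K" if "x \<in> generate G \<Gamma>" for x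
    using that
  proof induction
    case one then show ?case using \<Gamma> by (intro bexI[of _ \<Gamma>]) (auto simp: \<K>_def intro: generate.incl)
  next
    case (incl h) then show ?case using \<Gamma> by (intro bexI[of _ \<Gamma>]) (auto simp: \<K>_def intro: generate.incl)
  next
    case (inv h)
    have "connectedin (topol G) ((\<lambda>x. inv x) ` \<Gamma>)"
      by (rule connectedin_continuous_map_image[OF continuous_inverse \<Gamma>(3)])
    moreover have "\<one> \<in> (\<lambda>x. inv x) ` \<Gamma>" using \<Gamma>(2) by (metis imageI inv_one)
    ultimately have "(\<lambda>x. inv x) ` \<Gamma> \<in> \<K>" by (auto simp: \<K>_def intro: generate.inv)
    then show ?case using inv by blast
  next
    case (eng h1 h2)
    then obtain K1 K2 where K: "K1 \<in> \<K>" "h1 \<in> K1" "K2 \<in> \<K>" "h2 \<in> K2" by blast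
    have h1: "h1 \<in> carrier G" using generate_in_carrier[OF \<Gamma>(1) eng.hyps(1)] .
    have "connectedin (topol G) ((\<lambda>x. h1 \<otimes> x) ` K2)"
      using K by (intro connectedin_continuous_map_image[OF continuous_left_mult[OF h1]]) (simp add: \<K>_def)
    moreover have "h1 \<in> (\<lambda>x. h1 \<otimes> x) ` K2" using K h1 by (auto simp: \<K>_def intro!: image_eqI[of _ _ \<one>])
    ultimately have "connectedin (topol G) (K1 \<union> (\<lambda>x. h1 \<otimes> x) ` K2)"
      using K by (intro connectedin_Un) (auto simp: \<K>_def)
    moreover have "(\<lambda>x. h1 \<otimes> x) ` K2 \<subseteq> generate G \<Gamma>"
      using K eng.hyps(1) by (auto simp: \<K>_def intro: generate.eng)
    ultimately have "K1 \<union> (\<lambda>x. h1 \<otimes> x) ` K2 \<in> \<K>" using K by (auto simp: \<K>_def)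
    then show ?case using K(4) by (intro bexI[of _ "K1 \<union> (\<lambda>x. h1 \<otimes> x) ` K2"]) simp_all
  qed
  then have "\<Union>\<K> = generate G \<Gamma>" unfolding \<K>_def by fast
  moreover have "connectedin (topol G) (\<Union>\<K>)"
    using generate.one[of G \<Gamma>] \<Gamma>(2,3) by (intro connectedin_Union) (auto simp: \<K>_def)
  ultimately show ?thesis by simp
qed

lemma torus_generated_by_commuting_set:
  assumes "compact_space (topol G)"
    and \<Gamma>: "\<Gamma> \<subseteq> carrier G" "\<one> \<in> \<Gamma>" "connectedin (topol G) \<Gamma>"
    and comm: "\<And>x y. x \<in> \<Gamma> \<Longrightarrow> y \<in> \<Gamma> \<Longrightarrow> x \<otimes> y = y \<otimes> x"
  shows "\<exists>T. torus_in G T \<and> centralizer G T = centralizer G \<Gamma>"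
proof -
  let ?A = "generate G \<Gamma>"
  let ?T = "topol G closure_of ?A"
  have A: "?A \<subseteq> carrier G" using generate_in_carrier[OF \<Gamma>(1)] by blast
  have A_T: "?A \<subseteq> ?T" using A topspace_eq by (intro closure_of_subset) simp
  have to_T: "g \<in> centralizer G ?T" if "g \<in> centralizer G \<Gamma>" for g
    by (rule commute_closure[OF A commute_generate[OF \<Gamma>(1) that]])
  have "centralizer G ?T \<subseteq> centralizer G \<Gamma>"
    using A_T by (auto simp: centralizer_def intro: generate.incl)
  with to_T have eq: "centralizer G ?T = centralizer G \<Gamma>" by blast
  have sub: "subgroup ?T G" by (rule closure_subgroup[OF generate_is_subgroup[OF \<Gamma>(1)]])
  \<comment> \<open>Being contained in its own centralizer passes from the generators to the group they
    generate and then to its closure, since centralizers are closed subgroups.\<close>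
  have "?T \<subseteq> centralizer G \<Gamma>"
  proof
    fix y assume y: "y \<in> ?T"
    then have yc: "y \<in> carrier G" by (rule subgroup.mem_carrier[OF sub])
    have "x \<in> centralizer G ?T" if "x \<in> \<Gamma>" for x
      using that comm \<Gamma>(1) by (intro to_T) (auto simp: centralizer_def)
    then have "x \<otimes> y = y \<otimes> x" if "x \<in> \<Gamma>" for x using that y centralizerD by blast
    then show "y \<in> centralizer G \<Gamma>" using yc by (simp add: centralizer_def)
  qed
  then have "?T \<subseteq> centralizer G ?T" by (simp add: eq)
  then have "comm_group (G\<lparr>carrier := ?T\<rparr>)"
    using subgroup.subgroup_is_group[OF sub is_group]
    by (intro group.group_comm_groupI) (auto dest: centralizerD)
  moreover have "compactin (topol G) ?T"
    by (rule closedin_compact_space[OF assms(1)]) simp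
  moreover have "connectedin (topol G) ?T"
    by (rule connectedin_closure_of[OF generate_connected[OF \<Gamma>]])
  ultimately show ?thesis using eq sub by (auto simp: torus_in_def)
qed

end

section \<open>Stabilizers of functionals\<close>

context lie_group_chart
begin

text \<open>Riesz representation: the functional is the inner product with a vector \<open>h\<close> of the Lie algebra.\<close>

lemma functional_representative:
  assumes B: "inner_product_on (lie_algebra G (carrier G)) B"
    and \<xi>: "\<xi> \<in> dual (lie_algebra G (carrier G))"
  shows "\<exists>h. \<forall>v. B (tangent h) (tangent v) = \<xi> (tangent v)"
proof -
  obtain E :: "'v set" where E: "coordinate_frame E" by (rule model_frame)
  have mem: "tangent v \<in> lie_algebra G (carrier G)" for v by (simp add: lie_algebra_eq)
  have sym: "B (tangent u) (tangent w) = B (tangent w) (tangent u)" for u w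
    using B mem by (simp add: inner_product_on_def)
  have left: "linear (\<lambda>u. B (tangent u) (tangent w))" for w
    using B mem by (intro linearI) (simp_all add: inner_product_on_def tangent_add tangent_scale)
  have right: "linear (\<lambda>w. B (tangent u) (tangent w))" for u
    using left by (simp add: sym[of u])
  have pos: "B (tangent u) (tangent u) > 0" if "u \<noteq> 0" for u
  proof -
    have "tangent 0 = (\<lambda>f. 0)" using tangent_scale[of 0 0] by simp
    then have "tangent u \<noteq> (\<lambda>f. 0)" using that tangent_inject by metis
    then show ?thesis using B mem by (simp add: inner_product_on_def)
  qed
  have "linear (\<lambda>v. \<xi> (tangent v))"
    using \<xi> mem by (intro linearI) (simp_all add: dual_def tangent_add tangent_scale)
  from form_represents_functional[OF E left right pos this] show ?thesis by blast
qed

text \<open>By invariance of the inner product, moving the functional by the coadjoint action moves its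
representative by the adjoint action.\<close>

lemma stabilizer_eq:
  assumes B: "inner_product_on (lie_algebra G (carrier G)) B" and inv: "Ad_invariant G B"
    and \<xi>: "\<xi> \<in> dual (lie_algebra G (carrier G))"
    and h: "\<And>v. B (tangent h) (tangent v) = \<xi> (tangent v)"
  shows "stabilizer G (coAd G) \<xi> = {g \<in> carrier G. Ad_chart g h = h}"
proof -
  have mem: "tangent v \<in> lie_algebra G (carrier G)" for v by (simp add: lie_algebra_eq)
  have "coAd G g \<xi> = \<xi> \<longleftrightarrow> Ad_chart g h = h" if g: "g \<in> carrier G" for g
  proof -
    have "coAd G g \<xi> (tangent v) = B (tangent (Ad_chart g h)) (tangent v)" for v
    proof -
      have "coAd G g \<xi> (tangent v) = B (tangent h) (tangent (Ad_chart (inv g) v))"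
        using g mem by (simp add: coAd_def Ad_tangent h)
      also have "\<dots> = B (Ad G g (tangent h)) (Ad G g (tangent (Ad_chart (inv g) v)))"
        using inv g mem by (simp add: Ad_invariant_def)
      also have "\<dots> = B (tangent (Ad_chart g h)) (tangent v)"
        using g by (simp add: Ad_tangent Ad_chart_inverse)
      finally show ?thesis .
    qed
    moreover have "coAd G g \<xi> = \<xi> \<longleftrightarrow> (\<forall>v. coAd G g \<xi> (tangent v) = \<xi> (tangent v))"
    proof
      assume "\<forall>v. coAd G g \<xi> (tangent v) = \<xi> (tangent v)"
      then show "coAd G g \<xi> = \<xi>"
        using \<xi> by (intro extensionalityI[of _ "lie_algebra G (carrier G)"])
          (auto simp: coAd_def dual_def lie_algebra_eq)
    qed simp
    ultimately have "coAd G g \<xi> = \<xi> \<longleftrightarrow>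
        (\<forall>v. B (tangent (Ad_chart g h)) (tangent v) = B (tangent h) (tangent v))"
      by (simp add: h)
    also have "\<dots> \<longleftrightarrow> Ad_chart g h = h"
    proof
      assume *: "\<forall>v. B (tangent (Ad_chart g h)) (tangent v) = B (tangent h) (tangent v)"
      define u where "u = Ad_chart g h - h"
      have "tangent (Ad_chart g h) = (\<lambda>f. tangent u f + tangent h f)"
        using tangent_add[of u h] by (simp add: u_def)
      moreover have "B (\<lambda>f. tangent u f + tangent h f) (tangent u)
          = B (tangent u) (tangent u) + B (tangent h) (tangent u)"
        using B mem by (simp add: inner_product_on_def)
      ultimately have "B (tangent u) (tangent u) = 0" using *[rule_format, of u] by simp
      moreover have "tangent u \<noteq> (\<lambda>f. 0) \<longrightarrow> B (tangent u) (tangent u) > 0"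
        using B mem by (simp add: inner_product_on_def)
      ultimately have "tangent u = (\<lambda>f. 0)" by auto
      also have "\<dots> = tangent 0" using tangent_scale[of 0 0] by simp
      finally show "Ad_chart g h = h" using tangent_inject[of u 0] by (simp add: u_def)
    qed simp
    finally show ?thesis .
  qed
  then show ?thesis unfolding stabilizer_def by blast
qed

lemma conj_body_velocity:
  assumes g: "g \<in> carrier G" and c: "c t \<in> carrier G" "body_velocity c t v"
    and near: "\<forall>\<^sub>F h in nhds 0. c (t + h) \<in> carrier G"
  shows "body_velocity (\<lambda>t. g \<otimes> c t \<otimes> inv g) t (Ad_chart g v)"
proof -
  have "moves U \<phi> (\<lambda>h. g \<otimes> (inv (c t) \<otimes> c (t + h)) \<otimes> inv g) (Ad_chart g v)"
    using c by (intro conj_moves g) (auto simp: body_velocity_def)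
  moreover have "\<forall>\<^sub>F h in nhds 0. g \<otimes> (inv (c t) \<otimes> c (t + h)) \<otimes> inv g
      = inv (g \<otimes> c t \<otimes> inv g) \<otimes> (g \<otimes> c (t + h) \<otimes> inv g)"
    by (rule eventually_mono[OF near])
      (use g c in \<open>simp add: inv_mult_group m_assoc inv_mult_cancel\<close>)
  ultimately show ?thesis unfolding body_velocity_def by (rule moves_cong)
qed

lemma eventually_in_interval:
  fixes t :: real assumes "\<bar>t\<bar> < \<delta>" shows "\<forall>\<^sub>F h in nhds 0. \<bar>t + h\<bar> < \<delta>"
proof -
  have "((\<lambda>h. t + h) \<longlongrightarrow> t + 0) (nhds 0)" by (intro tendsto_intros filterlim_ident)
  then have "\<forall>\<^sub>F h in nhds 0. t + h \<in> {-\<delta><..<\<delta>}"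
    using assms by (intro topological_tendstoD) auto
  then show ?thesis by (rule eventually_mono) auto
qed

text \<open>Conjugation by \<open>g\<close> turns a curve with body velocity \<open>h\<close> into one with body velocity \<open>Ad g h\<close>.  If \<open>h\<close> is fixed,
uniqueness shows that \<open>g\<close> commutes with the curve; if \<open>g\<close> commutes with the curve, comparing
velocities at time \<open>0\<close> shows that \<open>h\<close> is fixed.\<close>

lemma Ad_fixed_eq_centralizer:
  assumes \<delta>: "0 < \<delta>" and c0: "c 0 = \<one>"
    and c: "\<And>t. \<bar>t\<bar> < \<delta> \<Longrightarrow> c t \<in> carrier G" "\<And>t. \<bar>t\<bar> < \<delta> \<Longrightarrow> body_velocity c t h"
  shows "{g \<in> carrier G. Ad_chart g h = h} = centralizer G (c ` {-\<delta><..<\<delta>})"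
proof -
  have "Ad_chart g h = h \<longleftrightarrow> (\<forall>t\<in>{-\<delta><..<\<delta>}. g \<otimes> c t = c t \<otimes> g)" if g: "g \<in> carrier G" for g
  proof -
    have near: "\<forall>\<^sub>F h in nhds 0. c (t + h) \<in> carrier G" if "\<bar>t\<bar> < \<delta>" for t
      by (rule eventually_mono[OF eventually_in_interval[OF that]]) (rule c(1))
    have conj_eq: "g \<otimes> c t \<otimes> inv g = c t \<longleftrightarrow> g \<otimes> c t = c t \<otimes> g" if "\<bar>t\<bar> < \<delta>" for t
      using g c(1)[OF that] inv_solve_right'[of "c t" "g \<otimes> c t" g] by auto
    have "Ad_chart g h = h \<longleftrightarrow> (\<forall>t\<in>{-\<delta><..<\<delta>}. g \<otimes> c t \<otimes> inv g = c t)"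
    proof (intro iffI ballI)
      fix t assume fixed: "Ad_chart g h = h" and t: "t \<in> {-\<delta><..<\<delta>}"
      show "g \<otimes> c t \<otimes> inv g = c t"
      proof (rule body_velocity_unique_curve[where I = "{-\<delta><..<\<delta>}" and ?t0.0 = 0 and v = h])
        fix s assume "s \<in> {-\<delta><..<\<delta>}"
        then have s: "\<bar>s\<bar> < \<delta>" by auto
        show "body_velocity (\<lambda>t. g \<otimes> c t \<otimes> inv g) s h"
          using conj_body_velocity[OF g c(1)[OF s] c(2)[OF s] near[OF s]] by (simp add: fixed)
        show "g \<otimes> c s \<otimes> inv g \<in> carrier G" using g c(1)[OF s] by simp
        show "c s \<in> carrier G" "body_velocity c s h" using c s by auto
      qed (use \<delta> t g c0 in auto)
    next
      assume *: "\<forall>t\<in>{-\<delta><..<\<delta>}. g \<otimes> c t \<otimes> inv g = c t"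
      have zero: "\<bar>0::real\<bar> < \<delta>" using \<delta> by simp
      have "\<forall>\<^sub>F t in nhds 0. inv (c 0) \<otimes> c (0 + t) = c t"
        by (rule eventually_mono[OF near[OF zero]]) (simp add: c0)
      with c(2)[OF zero] have c_moves: "moves U \<phi> c h"
        unfolding body_velocity_def by (rule moves_cong)
      have "\<forall>\<^sub>F t in nhds 0. g \<otimes> c t \<otimes> inv g = c t"
        by (rule eventually_mono[OF eventually_in_interval[OF zero]]) (use * in \<open>simp add: abs_less_iff\<close>)
      with conj_moves[OF g c_moves c0] have "moves U \<phi> c (Ad_chart g h)" by (rule moves_cong)
      then show "Ad_chart g h = h" using c_moves by (rule moves_unique)
    qed
    also have "\<dots> \<longleftrightarrow> (\<forall>t\<in>{-\<delta><..<\<delta>}. g \<otimes> c t = c t \<otimes> g)"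
      by (intro ball_cong refl conj_eq) auto
    finally show ?thesis .
  qed
  then show ?thesis by (auto simp: centralizer_def)
qed

text \<open>As functions of \<open>t\<close>, both sides solve the same left-invariant equation and agree at \<open>t = 0\<close>.  Halving
the interval keeps \<open>s + t\<close> in the domain.\<close>

lemma integral_curve_homomorphic:
  assumes c0: "c 0 = \<one>"
    and c: "\<And>t. \<bar>t\<bar> < \<epsilon> \<Longrightarrow> c t \<in> carrier G" "\<And>t. \<bar>t\<bar> < \<epsilon> \<Longrightarrow> body_velocity c t v"
    and st: "\<bar>s\<bar> < \<epsilon> / 2" "\<bar>t\<bar> < \<epsilon> / 2"
  shows "c s \<otimes> c t = c (s + t)"
proof (rule body_velocity_unique_curve[where I = "{-(\<epsilon>/2)<..<\<epsilon>/2}" and ?t0.0 = 0 and ?t1.0 = t and v = v])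
  have s: "c s \<in> carrier G" using c(1)[of s] st(1) by simp
  fix r assume "r \<in> {-(\<epsilon>/2)<..<\<epsilon>/2}"
  then have r: "\<bar>r\<bar> < \<epsilon>" "\<bar>s + r\<bar> < \<epsilon>" using st(1) by auto
  show "c s \<otimes> c r \<in> carrier G" "c (s + r) \<in> carrier G" using s c(1) r by auto
  have "\<forall>\<^sub>F h in nhds 0. inv (c r) \<otimes> c (r + h) = inv (c s \<otimes> c r) \<otimes> (c s \<otimes> c (r + h))"
    by (rule eventually_mono[OF eventually_in_interval[OF r(1)]])
      (use s c(1) r in \<open>simp add: inv_mult_group m_assoc inv_mult_cancel\<close>)
  with c(2)[OF r(1)] show "body_velocity (\<lambda>t. c s \<otimes> c t) r v"
    unfolding body_velocity_def by (rule moves_cong)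
  show "body_velocity (\<lambda>t. c (s + t)) r v"
    using c(2)[OF r(2)] by (simp add: body_velocity_def add.assoc)
qed (use st c0 c(1)[of s] in auto)

lemma stabilizer_is_centralizer_of_torus:
  assumes "compact_space (topol G)"
    and B: "inner_product_on (lie_algebra G (carrier G)) B" and inv: "Ad_invariant G B"
    and \<xi>: "\<xi> \<in> dual (lie_algebra G (carrier G))"
  shows "\<exists>T. torus_in G T \<and> stabilizer G (coAd G) \<xi> = centralizer G T"
proof -
  obtain h where h: "\<And>v. B (tangent h) (tangent v) = \<xi> (tangent v)"
    using functional_representative[OF B \<xi>] by blast
  obtain \<epsilon> c where \<epsilon>: "\<epsilon> > 0" and c0: "c 0 = \<one>"
    and cont: "continuous_map (top_of_set {-\<epsilon><..<\<epsilon>}) (topol G) c"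
    and c: "\<And>t. \<bar>t\<bar> < \<epsilon> \<Longrightarrow> c t \<in> carrier G" "\<And>t. \<bar>t\<bar> < \<epsilon> \<Longrightarrow> body_velocity c t h"
    using integral_curve_exists[of h] by blast
  define \<Gamma> where "\<Gamma> = c ` {-(\<epsilon>/2)<..<\<epsilon>/2}"
  have hom: "c s \<otimes> c t = c (s + t)" if "\<bar>s\<bar> < \<epsilon> / 2" "\<bar>t\<bar> < \<epsilon> / 2" for s t
    using c0 c that by (rule integral_curve_homomorphic)
  have "x \<otimes> y = y \<otimes> x" if xy: "x \<in> \<Gamma>" "y \<in> \<Gamma>" for x y
  proof -
    obtain s t where "x = c s" "y = c t" "\<bar>s\<bar> < \<epsilon> / 2" "\<bar>t\<bar> < \<epsilon> / 2"
      using xy by (auto simp: \<Gamma>_def abs_less_iff)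
    then show ?thesis
      using hom[of s t] hom[of t s] by (simp add: add.commute)
  qed
  moreover have "\<Gamma> \<subseteq> carrier G" using c(1) \<epsilon> by (auto simp: \<Gamma>_def)
  moreover have "\<one> \<in> \<Gamma>" using c0 \<epsilon> unfolding \<Gamma>_def by (intro image_eqI[of _ _ 0]) auto
  moreover have "connectedin (topol G) \<Gamma>"
  proof -
    have "connectedin (top_of_set {-\<epsilon><..<\<epsilon>}) {-(\<epsilon>/2)<..<\<epsilon>/2}"
      using \<epsilon> by (auto simp: connectedin_subtopology)
    then show ?thesis unfolding \<Gamma>_def by (rule connectedin_continuous_map_image[OF cont])
  qed
  ultimately obtain T where T: "torus_in G T" "centralizer G T = centralizer G \<Gamma>"
    using torus_generated_by_commuting_set[OF assms(1)] by blast
  have "stabilizer G (coAd G) \<xi> = {g \<in> carrier G. Ad_chart g h = h}"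
    by (rule stabilizer_eq[OF B inv \<xi> h])
  also have "\<dots> = centralizer G \<Gamma>"
    unfolding \<Gamma>_def by (rule Ad_fixed_eq_centralizer) (use \<epsilon> c0 c in auto)
  finally show ?thesis using T by blast
qed

end

lemma (in lie_group) torus_subset_centralizer:
  assumes "torus_in G T" shows "T \<subseteq> centralizer G T"
proof -
  interpret S: comm_group "G\<lparr>carrier := T\<rparr>" using assms by (simp add: torus_in_def)
  have "T \<subseteq> carrier G" using assms subgroup.subset by (auto simp: torus_in_def)
  then show ?thesis using S.m_comm by (auto simp: centralizer_def)
qed

theorem proposition1p2p22:
  fixes G :: "('a, 'v::real_inner) smooth_group"
    and T :: "'a set"
    and B :: "'a tangent \<Rightarrow> 'a tangent \<Rightarrow> real"
    and \<xi> :: "'a tangent \<Rightarrow> real"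
  assumes "lie_group G"
    and "compact_space (topol G)"
    and "connected_space (topol G)"
    and "maximal_torus_in G T"
    and "inner_product_on (lie_algebra G (carrier G)) B"
    and "Ad_invariant G B"
    and "\<xi> \<in> embedded_dual (lie_algebra G (carrier G)) B (lie_algebra G T)"
  shows "(\<exists>T\<^sub>1. torus_in G T\<^sub>1 \<and> stabilizer G (coAd G) \<xi> = centralizer G T\<^sub>1) \<and>
    (regular_functional G T \<xi> \<longrightarrow>
       torus_in G T \<and> stabilizer G (coAd G) \<xi> = centralizer G T \<and> stabilizer G (coAd G) \<xi> = T)"
proof -
  interpret lie_group G by fact
  have "\<exists>(U, \<phi>)\<in>atlas G. \<one>\<^bsub>G\<^esub> \<in> U" using charted by (simp add: charted_def topspace_eq)
  then obtain U \<phi> where "(U, \<phi>) \<in> atlas G" "\<one>\<^bsub>G\<^esub> \<in> U" by auto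
  then interpret lie_group_chart G U \<phi> by unfold_locales
  have "\<xi> \<in> dual (lie_algebra G (carrier G))" using assms(7) by (simp add: embedded_dual_def)
  from stabilizer_is_centralizer_of_torus[OF assms(2,5,6) this]
  obtain T1 where T1: "torus_in G T1" "stabilizer G (coAd G) \<xi> = centralizer G T1" by blast
  have T: "torus_in G T" using assms(4) by (simp add: maximal_torus_in_def)
  have "stabilizer G (coAd G) \<xi> = centralizer G T" if "stabilizer G (coAd G) \<xi> = T"
  proof
    show "stabilizer G (coAd G) \<xi> \<subseteq> centralizer G T"
      using torus_subset_centralizer[OF T] that by simp
    \<comment> \<open>A torus lies in its own centralizer, here the stabilizer T; and centralizers reverse
      inclusions.\<close>
    have "T1 \<subseteq> T" using torus_subset_centralizer[OF T1(1)] T1(2) that by simp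
    then show "centralizer G T \<subseteq> stabilizer G (coAd G) \<xi>"
      unfolding T1(2) by (auto simp: centralizer_def)
  qed
  moreover have "\<exists>T1. torus_in G T1 \<and> stabilizer G (coAd G) \<xi> = centralizer G T1"
    using T1 by (intro exI conjI)
  ultimately show ?thesis using T by (simp add: regular_functional_def)
qed

end
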